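(* Let $\mathcal X=\{x:\exists \xi: Ax+B\xi\leq_{\mathbf K_{\mathcal X}} c\}$ be a nonempty $\mathcal K$-represented set ($\mathbf K_{\mathcal X}\in\mathcal K$). Let $\mathcal Y=\{y:\exists\eta: Cy+D\eta\leq_{\mathbf K_{\mathcal Y}} e\}$ ($\mathbf K_{\mathcal Y}\in\mathcal K$) be nonempty and compact, this $\mathcal K$-representation of $\mathcal Y$ being essentially strictly feasible. Let $\psi:\mathcal X\times\mathcal Y\to\mathbb R$ be a continuous convex-concave function which is $\mathcal K$-representable on $\mathcal X\times\mathcal Y$: $$\psi(x,y)=\inf_{f,t,u}\{f^Ty+t: Pf+tp+Qu+Rx\leq_{\mathbf K}s\}\quad\forall x\in\mathcal X,\ y\in\mathcal Y,\qquad \mathbf K\in\mathcal K.$$ Put $\overline\Psi(x)=\max_{y\in\mathcal Y}\psi(x,y)$ for $x\in\mathcal X$, and consider the problems $$(a)\quad \inf_{x\in\mathcal X}\overline\Psi(x),$$ $$(b)\quad \inf_{x,\xi,f,t,u,\lambda}\left\{e^T\lambda+t:\ \begin{array}{l}Pf+tp+Qu+Rx\leq_{\mathbf K}s,\\ C^T\lambda=f,\ D^T\lambda=0,\ \lambda\geq_{\mathbf K_{\mathcal Y}^*}0,\\ Ax+B\xi\leq_{\mathbf K_{\mathcal X}}c\end{array}\right\}.$$ Then (b) is a reformulation of (a) as a $\mathcal K$-conic problem in the following sense: for every feasible solution $\zeta=(x,\xi,f,t,u,\lambda)$ of (b), the component $x$ is feasible for (a) and $\overline\Psi(x)\leq e^T\lambda+t$;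 and the optimal values of (a) and (b) are equal.
   Context: $\mathcal K$ is a fixed family of regular cones (closed, convex, pointed, with nonempty interior) in Euclidean spaces which contains the nonnegative ray $\mathbb R_+$, is closed under finite direct products, and is closed under passing from a cone $\mathbf K$ to its dual cone $\mathbf K^*$. For a cone $\mathbf K$, $a\leq_{\mathbf K}b$ (equivalently $b\geq_{\mathbf K}a$) means $b-a\in\mathbf K$. A $\mathcal K$-conic constraint is a constraint $Ax\leq_{\mathbf K}a$ with $\mathbf K\in\mathcal K$; finite systems of such constraints, linear equalities and nonstrict linear inequalities are again (equivalent to) $\mathcal K$-conic constraints. A $\mathcal K$-conic problem is the minimization of a linear function under a $\mathcal K$-conic constraint. A set $X$ is $\mathcal K$-representable if $X=\{x:\exists u: Ax+Bu\leq_{\mathbf K}c\}$ for some $A,B,c$ and $\mathbf K\in\mathcal K$; the constraint is then called a $\mathcal K$-representation of $X$. A conic constraint $Ax\leq_{\mathbf K}a$ is essentially strictly feasible if $\mathbf K=\mathbb R^m_+\times\mathbf L$ with regular $\mathbf L$ (either factor may be absent), so that it reads $Px\leq p$, $Qx\leq_{\mathbf L}q$, and there is $\bar x$ with $P\bar x\leq p$ and $q-Q\bar x\in\operatorname{int}\mathbf L$. Essential strict feasibility of a representation $Ax+Bu\leq_{\mathbf K}c$ of a set refers to this constraint in variables $(x,u)$. Convex-concave means convex in $x\in\mathcal X$ for fixed $y$ and concave in $y\in\mathcal Y$ for fixed $x$. *)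

theory Defs
  imports
    "HOL-Analysis.Abstract_Euclidean_Space"
    "HOL-Library.Extended_Real"
    "Jordan_Normal_Form.Matrix"
begin

no_notation inner (infix "\<bullet>" 70)

text \<open>
  Since a family of cones ranges over Euclidean spaces of all dimensions, the space \<open>\<real>\<^sup>n\<close> is
  \<^term>\<open>carrier_vec n\<close>, with the Euclidean topology transported from the library space
  \<^const>\<open>Euclidean_space\<close> of sequences vanishing from index \<open>n\<close> on.
\<close>

definition euclid :: "nat \<Rightarrow> real vec topology" where
  "euclid n = pullback_topology (carrier_vec n) (\<lambda>v i. if i < n then v $ i else 0)
                (Euclidean_space n)"

definition vec_convex :: "real vec set \<Rightarrow> bool" where
  "vec_convex S \<longleftrightarrow>
     (\<forall>x\<in>S. \<forall>y\<in>S. \<forall>a b. 0 \<le> a \<longrightarrow> 0 \<le> b \<longrightarrow> a + b = 1 \<longrightarrow> a \<cdot>\<^sub>v x + b \<cdot>\<^sub>v y \<in> S)"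

definition vec_convex_on :: "real vec set \<Rightarrow> (real vec \<Rightarrow> real) \<Rightarrow> bool" where
  "vec_convex_on S g \<longleftrightarrow> vec_convex S \<and>
     (\<forall>x\<in>S. \<forall>y\<in>S. \<forall>a b. 0 \<le> a \<longrightarrow> 0 \<le> b \<longrightarrow> a + b = 1 \<longrightarrow>
        g (a \<cdot>\<^sub>v x + b \<cdot>\<^sub>v y) \<le> a * g x + b * g y)"

definition vec_concave_on :: "real vec set \<Rightarrow> (real vec \<Rightarrow> real) \<Rightarrow> bool" where
  "vec_concave_on S g \<longleftrightarrow> vec_convex_on S (\<lambda>x. - g x)"

definition convex_concave_on ::
    "real vec set \<Rightarrow> real vec set \<Rightarrow> (real vec \<Rightarrow> real vec \<Rightarrow> real) \<Rightarrow> bool" where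
  "convex_concave_on X Y \<psi> \<longleftrightarrow>
     (\<forall>y\<in>Y. vec_convex_on X (\<lambda>x. \<psi> x y)) \<and> (\<forall>x\<in>X. vec_concave_on Y (\<psi> x))"

definition regular_cone :: "nat \<Rightarrow> real vec set \<Rightarrow> bool" where
  "regular_cone n K \<longleftrightarrow>
     K \<subseteq> carrier_vec n \<and>
     (\<forall>x\<in>K. \<forall>a\<ge>0. a \<cdot>\<^sub>v x \<in> K) \<and>
     vec_convex K \<and>
     closedin (euclid n) K \<and>
     (\<forall>x\<in>K. - x \<in> K \<longrightarrow> x = 0\<^sub>v n) \<and>
     euclid n interior_of K \<noteq> {}"

definition orthant :: "nat \<Rightarrow> real vec set" where
  "orthant n = {v \<in> carrier_vec n. 0\<^sub>v n \<le> v}"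

definition cone_prod :: "real vec set \<Rightarrow> real vec set \<Rightarrow> real vec set" where
  "cone_prod K L = {v @\<^sub>v w | v w. v \<in> K \<and> w \<in> L}"

definition dual_cone :: "nat \<Rightarrow> real vec set \<Rightarrow> real vec set" where
  "dual_cone n K = {y \<in> carrier_vec n. \<forall>x\<in>K. 0 \<le> y \<bullet> x}"

text \<open>The members of the family \<open>\<K>\<close> that live in \<open>\<real>\<^sup>n\<close> are the elements of \<open>\<K> n\<close>.\<close>

definition cone_family :: "(nat \<Rightarrow> real vec set set) \<Rightarrow> bool" where
  "cone_family \<K> \<longleftrightarrow>
     (\<forall>n. \<forall>K\<in>\<K> n. regular_cone n K) \<and>
     orthant 1 \<in> \<K> 1 \<and>
     (\<forall>m n. \<forall>K\<in>\<K> m. \<forall>L\<in>\<K> n. cone_prod K L \<in> \<K> (m + n)) \<and>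
     (\<forall>n. \<forall>K\<in>\<K> n. dual_cone n K \<in> \<K> n)"

definition cone_le :: "real vec \<Rightarrow> real vec set \<Rightarrow> real vec \<Rightarrow> bool"
    ("(_/ \<preceq>\<^bsub>_\<^esub> _)" [51, 0, 51] 50) where
  "a \<preceq>\<^bsub>K\<^esub> b \<longleftrightarrow> b - a \<in> K"

definition append_cols :: "real mat \<Rightarrow> real mat \<Rightarrow> real mat" (infixr "@\<^sub>c" 65) where
  "A @\<^sub>c B = four_block_mat A B (0\<^sub>m 0 (dim_col A)) (0\<^sub>m 0 (dim_col B))"

text \<open>The set with representation \<open>Ax + Bu \<preceq> c\<close> with respect to \<open>K\<close>.\<close>

definition represented_set ::
    "real vec set \<Rightarrow> real mat \<Rightarrow> real mat \<Rightarrow> real vec \<Rightarrow> real vec set" where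
  "represented_set K A B c =
     {x \<in> carrier_vec (dim_col A). \<exists>u \<in> carrier_vec (dim_col B). A *\<^sub>v x + B *\<^sub>v u \<preceq>\<^bsub>K\<^esub> c}"

text \<open>
  Essential strict feasibility of \<open>Mz \<preceq> a\<close> with respect to \<open>K\<close>. An absent factor of \<open>K\<close> is
  covered by dimension \<open>m = 0\<close> or \<open>l = 0\<close>.
\<close>

definition ess_strictly_feasible :: "real vec set \<Rightarrow> real mat \<Rightarrow> real vec \<Rightarrow> bool" where
  "ess_strictly_feasible K M a \<longleftrightarrow>
     (\<exists>m l L P Q p q.
        regular_cone l L \<and> K = cone_prod (orthant m) L \<and>
        P \<in> carrier_mat m (dim_col M) \<and> Q \<in> carrier_mat l (dim_col M) \<and> M = P @\<^sub>r Q \<and>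
        p \<in> carrier_vec m \<and> q \<in> carrier_vec l \<and> a = p @\<^sub>v q \<and>
        (\<exists>z \<in> carrier_vec (dim_col M).
           P *\<^sub>v z \<le> p \<and> q - Q *\<^sub>v z \<in> euclid l interior_of L))"

text \<open>
  The set of \<open>(f,t,u)\<close> over which the infimum in the representation of \<open>\<psi>\<close> is taken, for given \<open>x\<close>.
\<close>

definition saddle_repr_set ::
    "real vec set \<Rightarrow> real mat \<Rightarrow> real vec \<Rightarrow> real mat \<Rightarrow> real mat \<Rightarrow> real vec \<Rightarrow> real vec
      \<Rightarrow> (real vec \<times> real \<times> real vec) set" where
  "saddle_repr_set K P p Q R s x =
     {(f, t, u). f \<in> carrier_vec (dim_col P) \<and> u \<in> carrier_vec (dim_col Q) \<and>
        P *\<^sub>v f + t \<cdot>\<^sub>v p + Q *\<^sub>v u + R *\<^sub>v x \<preceq>\<^bsub>K\<^esub> s}"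

text \<open>
  The infimum is taken in \<^typ>\<open>ereal\<close>, where the empty set has infimum \<open>\<infinity>\<close>.
\<close>

definition saddle_represents ::
    "real vec set \<Rightarrow> real vec set \<Rightarrow> (real vec \<Rightarrow> real vec \<Rightarrow> real) \<Rightarrow> real vec set \<Rightarrow>
      real mat \<Rightarrow> real vec \<Rightarrow> real mat \<Rightarrow> real mat \<Rightarrow> real vec \<Rightarrow> bool" where
  "saddle_represents X Y \<psi> K P p Q R s \<longleftrightarrow>
     (\<forall>x\<in>X. \<forall>y\<in>Y.
        ereal (\<psi> x y) = (INF (f, t, u) \<in> saddle_repr_set K P p Q R s x. ereal (f \<bullet> y + t)))"

text \<open>A maximum whenever \<open>\<psi> x\<close> is continuous on a nonempty compact \<open>Y\<close>.\<close>

definition Psi_bar ::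
    "real vec set \<Rightarrow> (real vec \<Rightarrow> real vec \<Rightarrow> real) \<Rightarrow> real vec \<Rightarrow> real" where
  "Psi_bar Y \<psi> x = (SUP y\<in>Y. \<psi> x y)"

text \<open>
  Minimizing \<open>obj\<close> over \<open>F\<close>, where the decision variables range over \<open>V\<close> and \<open>coord\<close> identifies
  \<open>V\<close> with \<open>\<real>\<^sup>N\<close>, is a \<open>\<K>\<close>-conic problem.
\<close>

definition conic_problem ::
    "(nat \<Rightarrow> real vec set set) \<Rightarrow> nat \<Rightarrow> 'z set \<Rightarrow> ('z \<Rightarrow> real vec) \<Rightarrow> 'z set \<Rightarrow> ('z \<Rightarrow> real) \<Rightarrow> bool"
  where
  "conic_problem \<K> N V coord F obj \<longleftrightarrow>
     bij_betw coord V (carrier_vec N) \<and>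
     (\<exists>k K M a g. K \<in> \<K> k \<and> M \<in> carrier_mat k N \<and> a \<in> carrier_vec k \<and> g \<in> carrier_vec N \<and>
        F = {\<zeta> \<in> V. M *\<^sub>v coord \<zeta> \<preceq>\<^bsub>K\<^esub> a} \<and>
        (\<forall>\<zeta>\<in>V. obj \<zeta> = g \<bullet> coord \<zeta>))"

text \<open>The decision vectors of problem (b), in the order \<open>(x, \<xi>, f, t, u, \<mu>)\<close>;
  \<open>\<mu>\<close> is the conic multiplier of the constraint defining \<open>\<Y>\<close>.\<close>

type_synonym decision = "real vec \<times> real vec \<times> real vec \<times> real \<times> real vec \<times> real vec"

definition decisions :: "nat \<Rightarrow> nat \<Rightarrow> nat \<Rightarrow> nat \<Rightarrow> nat \<Rightarrow> decision set" where
  "decisions nx n\<xi> nf nu n\<mu> =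
     {(x, \<xi>, f, t, u, \<mu>). x \<in> carrier_vec nx \<and> \<xi> \<in> carrier_vec n\<xi> \<and> f \<in> carrier_vec nf \<and>
        u \<in> carrier_vec nu \<and> \<mu> \<in> carrier_vec n\<mu>}"

fun stack :: "decision \<Rightarrow> real vec" where
  "stack (x, \<xi>, f, t, u, \<mu>) = x @\<^sub>v \<xi> @\<^sub>v f @\<^sub>v vec_of_list [t] @\<^sub>v u @\<^sub>v \<mu>"

end

theory Submission
  imports Defs
begin

text \<open>
  Fix \<open>x \<in> X\<close> and \<open>v > \<Psi>(x)\<close>. A feasible point of (b) over \<open>x\<close> with value below \<open>v\<close> is a common point
  of the convex sets \<open>G = {(t, f)}\<close>, the projection of the representation of \<open>\<psi>(x, \<cdot>)\<close>, and
  \<open>H = {(t, C\<^sup>T \<mu>) | D\<^sup>T \<mu> = 0, \<mu> \<in> K\<^sub>Y\<^sup>*, e\<^sup>T \<mu> + t < v}\<close>. If they were disjoint, a separating functional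
  \<open>(b, a)\<close> would have \<open>b \<ge> 0\<close>. When \<open>b = 0\<close>, the vector \<open>a \<noteq> 0\<close> is a recession direction of \<open>Y\<close>, against
  compactness. When \<open>b > 0\<close>, the points of the segment from \<open>a / b\<close> to a Slater point \<open>x\<^sub>0\<close>, with \<open>a / b\<close>
  itself excluded, lie in \<open>Y\<close>, and \<open>\<psi>(x, \<cdot>)\<close> is almost \<open>v\<close> near \<open>a / b\<close>, against \<open>\<Psi>(x) < v\<close>. So the
  minimax argument and the conic duality argument collapse into one separation, and attainment
  of the dual optimum is never used.
\<close>

text \<open>Neither of the two separated sets need be closed, so the separation theorem is one for
  arbitrary disjoint convex sets and yields only a weak inequality. The positive gap
  \<open>v - \<Psi>(x)\<close> makes up for this. The sign of \<open>b\<close> comes from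
  \<open>t\<close> being unbounded below in \<open>H\<close>. The missing closedness is also why
  \<open>a / b\<close> is left out of the segment. Since the multipliers form a cone, separation
  gives \<open>\<mu> \<bullet> (C *\<^sub>v (a / b)) \<le> e \<bullet> \<mu>\<close> for all
  admissible \<open>\<mu>\<close>, but this alone does not place \<open>a / b\<close> in
  \<open>Y\<close>. A point slightly nearer to \<open>x\<^sub>0\<close> keeps a positive fraction of
  the slack of \<open>x\<^sub>0\<close> against every multiplier, and that does place it in
  \<open>Y\<close>. The lower bound survives the move because it is a bound on affine functions:
  every \<open>f \<bullet> y + t\<close> with \<open>(f, t)\<close> in the representation is at
  least \<open>v\<close> at \<open>y = a / b\<close>, even where \<psi> carries no information, and
  the infimum of these functions is concave along the segment.\<close>

no_notation Finite_Cartesian_Product.vec.vec_nth (infixl "$" 90)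

section \<open>Separation of convex sets in coordinate space\<close>

lemma vCons_add: "dim_vec v = dim_vec w \<Longrightarrow> vCons a v + vCons b w = vCons (a + b) (v + w :: real vec)"
  by (rule eq_vecI) (auto simp: vec_index_vCons)

lemma vCons_smult: "c \<cdot>\<^sub>v vCons a v = vCons (c * a) (c \<cdot>\<^sub>v v :: real vec)"
  by (rule eq_vecI) (auto simp: vec_index_vCons)

lemma carrier_vec_SucE:
  assumes "v \<in> carrier_vec (Suc n)"
  obtains a w where "v = vCons a w" "w \<in> carrier_vec n"
  using assms by (cases v) auto

lemma carrier_vec_0_eq: "v \<in> carrier_vec 0 \<Longrightarrow> w \<in> carrier_vec 0 \<Longrightarrow> v = w"
  by auto

text \<open>Hahn-Banach in coordinates. Once a coefficient for the first coordinate is fixed,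
  minimising the remainder over that coordinate gives a sublinear function of one variable less.
  Homogeneity is assumed for positive factors only; \<open>0 \<le> p 0\<close> follows from
  subadditivity.\<close>

lemma scalar_prod_linear_bound:
  fixes p :: "real vec \<Rightarrow> real"
  assumes "\<And>x y. x \<in> carrier_vec n \<Longrightarrow> y \<in> carrier_vec n \<Longrightarrow> p (x + y) \<le> p x + p y"
    and "\<And>x c. x \<in> carrier_vec n \<Longrightarrow> 0 < c \<Longrightarrow> p (c \<cdot>\<^sub>v x) = c * p x"
  shows "\<exists>a\<in>carrier_vec n. \<forall>x\<in>carrier_vec n. a \<bullet> x \<le> p x"
  using assms
proof (induction n arbitrary: p)
  case 0
  have "0 \<le> p x" if x: "x \<in> carrier_vec 0" for x
  proof -
    have "x + x = x" using x by (intro carrier_vec_0_eq) auto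
    with 0(1)[OF x x] show ?thesis by simp
  qed
  then show ?case by (intro bexI[of _ "0\<^sub>v 0"]) (auto simp: scalar_prod_def)
next
  case (Suc n)
  note sub = Suc.prems(1) and hom = Suc.prems(2)
  define e where "e = vCons 1 (0\<^sub>v n :: real vec)"
  \<comment> \<open>Any coefficient between \<open>- p (- e)\<close> and \<open>p e\<close> keeps
    the functional below \<open>p\<close> on the first axis; the upper end is taken.\<close>
  define \<alpha> where "\<alpha> = p e"
  have e: "e \<in> carrier_vec (Suc n)" by (simp add: e_def)
  have p0: "0 \<le> p (0\<^sub>v (Suc n))"
    using sub[of "0\<^sub>v (Suc n)" "0\<^sub>v (Suc n)"] by simp
  have pe: "\<alpha> * s \<le> p (vCons s (0\<^sub>v n))" for s
  proof (cases s "0::real" rule: linorder_cases)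
    case greater
    have "s \<cdot>\<^sub>v e = vCons s (0\<^sub>v n)" by (auto simp: e_def vCons_smult)
    then show ?thesis
      using hom[OF e greater] by (simp add: \<alpha>_def mult.commute)
  next
    case equal
    then show ?thesis using p0 by (simp add: zero_vec_Suc)
  next
    case less
    let ?m = "(- s) \<cdot>\<^sub>v e"
    have "0\<^sub>v (Suc n) = vCons s (0\<^sub>v n) + ?m"
      by (auto simp: e_def vCons_smult vCons_add zero_vec_Suc)
    then have "0 \<le> p (vCons s (0\<^sub>v n)) + p ?m"
      using p0 sub[of "vCons s (0\<^sub>v n)" ?m] e by simp
    moreover have "p ?m = - s * \<alpha>" using hom[OF e, of "- s"] less by (simp add: \<alpha>_def)
    ultimately show ?thesis by (simp add: mult.commute)
  qed
  define q where "q x s = p (vCons s x) - \<alpha> * s" for x s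
  have q_add: "q (x + y) (s + t) \<le> q x s + q y t"
    if "x \<in> carrier_vec n" "y \<in> carrier_vec n" for x y s t
  proof -
    have "vCons (s + t) (x + y) = vCons s x + vCons t y"
      using that by (subst vCons_add) auto
    then show ?thesis
      using sub[of "vCons s x" "vCons t y"] that by (simp add: q_def algebra_simps)
  qed
  have q_hom: "q (c \<cdot>\<^sub>v x) (c * s) = c * q x s" if "x \<in> carrier_vec n" "0 < c" for x c s
    using hom[of "vCons s x" c] that by (simp add: q_def vCons_smult algebra_simps)
  \<comment> \<open>The infimum over the first coordinate is finite because
    \<open>q x s + q (- x) 0\<close> dominates \<open>q 0 s\<close>, which is nonnegative by the
    choice of \<alpha>.\<close>
  have bdd: "bdd_below (range (q x))" if x: "x \<in> carrier_vec n" for x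
  proof (rule bdd_belowI2[of _ "- q (- x) 0"])
    fix s
    have "x + - x = 0\<^sub>v n" using x by auto
    then have "q (0\<^sub>v n) s \<le> q x s + q (- x) 0"
      using q_add[of x "- x" s 0] x by simp
    moreover have "0 \<le> q (0\<^sub>v n) s" using pe[of s] by (simp add: q_def)
    ultimately show "- q (- x) 0 \<le> q x s" by simp
  qed
  define p' where "p' x = (INF s. q x s)" for x
  have lower: "p' x \<le> q x s" if "x \<in> carrier_vec n" for x s
    unfolding p'_def by (rule cINF_lower[OF bdd[OF that]]) simp
  have "\<exists>a\<in>carrier_vec n. \<forall>x\<in>carrier_vec n. a \<bullet> x \<le> p' x"
  proof (rule Suc.IH)
    fix x y :: "real vec" assume x: "x \<in> carrier_vec n" and y: "y \<in> carrier_vec n"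
    have "p' (x + y) - q x s \<le> q y t" for s t
      using lower[of "x + y" "s + t"] q_add[OF x y, of s t] x y by simp
    then have "p' (x + y) - q x s \<le> p' y" for s
      unfolding p'_def[of y] by (intro cINF_greatest) auto
    then have "p' (x + y) - p' y \<le> q x s" for s by (simp add: algebra_simps)
    then have "p' (x + y) - p' y \<le> p' x"
      unfolding p'_def[of x] by (intro cINF_greatest) auto
    then show "p' (x + y) \<le> p' x + p' y" by simp
  next
    \<comment> \<open>One inequality for all positive factors is enough: the reverse one is its
      instance at \<open>1 / c\<close>.\<close>
    have le: "p' (c \<cdot>\<^sub>v x) \<le> c * p' x" if x: "x \<in> carrier_vec n" and c: "0 < c" for x c
    proof -
      have "p' (c \<cdot>\<^sub>v x) / c \<le> q x s" for s
        using lower[of "c \<cdot>\<^sub>v x" "c * s"] q_hom[OF x c, of s] x c by (simp add: field_simps)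
      then have "p' (c \<cdot>\<^sub>v x) / c \<le> p' x"
        unfolding p'_def[of x] by (intro cINF_greatest) auto
      then show ?thesis using c by (simp add: field_simps)
    qed
    fix x :: "real vec" and c :: real assume x: "x \<in> carrier_vec n" and c: "0 < c"
    have "p' ((1 / c) \<cdot>\<^sub>v (c \<cdot>\<^sub>v x)) \<le> (1 / c) * p' (c \<cdot>\<^sub>v x)"
      using le[of "c \<cdot>\<^sub>v x" "1 / c"] x c by simp
    then have "c * p' x \<le> p' (c \<cdot>\<^sub>v x)"
      using c by (simp add: smult_smult_assoc field_simps)
    with le[OF x c] show "p' (c \<cdot>\<^sub>v x) = c * p' x" by simp
  qed
  then obtain a where a: "a \<in> carrier_vec n" "\<And>x. x \<in> carrier_vec n \<Longrightarrow> a \<bullet> x \<le> p' x" by blast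
  show ?case
  proof (intro bexI[of _ "vCons \<alpha> a"] ballI)
    fix x :: "real vec" assume "x \<in> carrier_vec (Suc n)"
    then obtain s y where x: "x = vCons s y" "y \<in> carrier_vec n" by (rule carrier_vec_SucE)
    show "vCons \<alpha> a \<bullet> x \<le> p x"
      using a(2)[OF x(2)] lower[OF x(2), of s] by (simp add: x(1) q_def)
  qed (use a in simp)
qed

text \<open>
  No closedness or interior is assumed. Induction on the dimension: project away the first
  coordinate. If the projection is everything, the infimum over the fibres is a finite sublinear
  function, and a linear minorant of it gives the functional.
\<close>

lemma convex_cone_supporting_functional:
  fixes K :: "real vec set"
  assumes "K \<subset> carrier_vec n" "0\<^sub>v n \<in> K"
    and "\<And>x y. x \<in> K \<Longrightarrow> y \<in> K \<Longrightarrow> x + y \<in> K"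
    and "\<And>x c. x \<in> K \<Longrightarrow> 0 < c \<Longrightarrow> c \<cdot>\<^sub>v x \<in> K"
  shows "\<exists>a\<in>carrier_vec n. a \<noteq> 0\<^sub>v n \<and> (\<forall>x\<in>K. 0 \<le> a \<bullet> x)"
  using assms
proof (induction n arbitrary: K)
  case 0
  then show ?case using carrier_vec_0_eq by blast
next
  case (Suc n)
  note add = Suc.prems(3) and scale = Suc.prems(4)
  define K' where "K' = {x \<in> carrier_vec n. \<exists>s. vCons s x \<in> K}"
  show ?case
  proof (cases "K' = carrier_vec n")
    case False
    have "\<exists>a\<in>carrier_vec n. a \<noteq> 0\<^sub>v n \<and> (\<forall>x\<in>K'. 0 \<le> a \<bullet> x)"
    proof (rule Suc.IH)
      show "K' \<subset> carrier_vec n" using False by (auto simp: K'_def)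
      show "0\<^sub>v n \<in> K'" using Suc.prems(2) by (auto simp: K'_def zero_vec_Suc)
      show "x + y \<in> K'" if xy: "x \<in> K'" "y \<in> K'" for x y
      proof -
        obtain s t where "vCons s x \<in> K" "vCons t y \<in> K" "x \<in> carrier_vec n" "y \<in> carrier_vec n"
          using xy by (auto simp: K'_def)
        then show ?thesis using add[of "vCons s x" "vCons t y"] by (auto simp: K'_def vCons_add)
      qed
      show "c \<cdot>\<^sub>v x \<in> K'" if xc: "x \<in> K'" "0 < c" for x c
        using xc scale[of "vCons _ x" c] by (auto simp: K'_def vCons_smult)
    qed
    then obtain a where a: "a \<in> carrier_vec n" "a \<noteq> 0\<^sub>v n" "\<And>x. x \<in> K' \<Longrightarrow> 0 \<le> a \<bullet> x" by blast
    show ?thesis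
    proof (intro bexI[of _ "vCons 0 a"] conjI ballI)
      fix x assume x: "x \<in> K"
      then have "x \<in> carrier_vec (Suc n)" using Suc.prems(1) by blast
      then obtain s y where "x = vCons s y" "y \<in> carrier_vec n" by (rule carrier_vec_SucE)
      then show "0 \<le> vCons 0 a \<bullet> x" using a(3)[of y] x by (auto simp: K'_def)
    qed (use a in \<open>auto simp: zero_vec_Suc\<close>)
  next
    case True
    \<comment> \<open>If every nonzero height over the origin occurred in \<open>K\<close>, then,
      the projection being onto, \<open>K\<close> would be the whole space. A missing height
      \<open>- \<sigma>\<close> fixes the side of the origin that the fibre avoids.\<close>
    obtain \<sigma> :: real where \<sigma>: "\<sigma> \<noteq> 0" "vCons (- \<sigma>) (0\<^sub>v n) \<notin> K"
    proof (rule ccontr)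
      assume "\<not> thesis"
      then have all: "\<sigma> \<noteq> 0 \<Longrightarrow> vCons (- \<sigma>) (0\<^sub>v n) \<in> K" for \<sigma> using that by blast
      have fib: "vCons s (0\<^sub>v n) \<in> K" for s
        using all[of "- s"] Suc.prems(2) by (cases "s = 0") (auto simp: zero_vec_Suc)
      have "x \<in> K" if xc: "x \<in> carrier_vec (Suc n)" for x
      proof -
        obtain s y where x: "x = vCons s y" "y \<in> carrier_vec n" using xc by (rule carrier_vec_SucE)
        then obtain t where "vCons t y \<in> K" using True by (auto simp: K'_def)
        then show ?thesis using add[OF _ fib, of "vCons t y" "s - t"] x by (simp add: vCons_add)
      qed
      then show False using Suc.prems(1) by blast
    qed
    \<comment> \<open>Heights of the fibre over \<open>x\<close>, oriented by \<sigma> so that those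
      over the origin are nonnegative: a negative one could be rescaled to the missing height.
      Opposite fibres then bound each other from below.\<close>
    define T where "T x = {\<sigma> * s | s. vCons s x \<in> K}" for x
    have T_ne: "T x \<noteq> {}" if "x \<in> carrier_vec n" for x
      using that True by (auto simp: T_def K'_def)
    have T_0: "0 \<le> r" if rT: "r \<in> T (0\<^sub>v n)" for r
    proof (rule ccontr)
      assume r: "\<not> 0 \<le> r"
      obtain s where s: "r = \<sigma> * s" "vCons s (0\<^sub>v n) \<in> K" using rT by (auto simp: T_def)
      have pos: "0 < - (\<sigma> / s)" using r s \<sigma>(1) by (auto simp: divide_less_0_iff mult_less_0_iff not_le)
      have "- (\<sigma> / s) \<cdot>\<^sub>v vCons s (0\<^sub>v n) = vCons (- \<sigma>) (0\<^sub>v n)"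
        using r s(1) by (auto simp: vCons_smult)
      then have "vCons (- \<sigma>) (0\<^sub>v n) \<in> K" using scale[OF s(2) pos] by simp
      with \<sigma>(2) show False by simp
    qed
    have T_add: "r + r' \<in> T (x + y)"
      if "r \<in> T x" "r' \<in> T y" "x \<in> carrier_vec n" "y \<in> carrier_vec n" for r r' x y
    proof -
      obtain s t where "r = \<sigma> * s" "vCons s x \<in> K" "r' = \<sigma> * t" "vCons t y \<in> K"
        using \<open>r \<in> T x\<close> \<open>r' \<in> T y\<close> by (auto simp: T_def)
      then show ?thesis using add[of "vCons s x" "vCons t y"] that(3,4)
        by (auto simp: T_def vCons_add intro!: exI[of _ "s + t"] simp: algebra_simps)
    qed
    have T_scale: "c * r \<in> T (c \<cdot>\<^sub>v x)" if "r \<in> T x" "0 < c" for r c x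
    proof -
      obtain s where "r = \<sigma> * s" "vCons s x \<in> K" using \<open>r \<in> T x\<close> by (auto simp: T_def)
      then show ?thesis using scale[of "vCons s x" c] that(2)
        by (auto simp: T_def vCons_smult intro!: exI[of _ "c * s"])
    qed
    have bdd: "bdd_below (T x)" if x: "x \<in> carrier_vec n" for x
    proof -
      obtain r' where r': "r' \<in> T (- x)" using T_ne[of "- x"] x by auto
      have "x + - x = 0\<^sub>v n" using x by auto
      then have "- r' \<le> r" if "r \<in> T x" for r
        using T_0[of "r + r'"] T_add[OF that r'] x by simp
      then show ?thesis by (rule bdd_belowI)
    qed
    have lower: "Inf (T x) \<le> r" if "x \<in> carrier_vec n" "r \<in> T x" for x r
      using bdd that by (intro cInf_lower) auto
    have "\<exists>a\<in>carrier_vec n. \<forall>x\<in>carrier_vec n. a \<bullet> x \<le> Inf (T x)"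
    proof (rule scalar_prod_linear_bound)
      fix x y :: "real vec" assume x: "x \<in> carrier_vec n" and y: "y \<in> carrier_vec n"
      have "Inf (T (x + y)) - r \<le> r'" if "r \<in> T x" "r' \<in> T y" for r r'
        using lower[OF _ T_add[OF that x y]] x y by simp
      then have "Inf (T (x + y)) - r \<le> Inf (T y)" if "r \<in> T x" for r
        using that T_ne[OF y] by (intro cInf_greatest) auto
      then have "Inf (T (x + y)) - Inf (T y) \<le> r" if "r \<in> T x" for r
        using that by (smt (verit))
      then have "Inf (T (x + y)) - Inf (T y) \<le> Inf (T x)"
        using T_ne[OF x] by (intro cInf_greatest) auto
      then show "Inf (T (x + y)) \<le> Inf (T x) + Inf (T y)" by simp
    next
      have le: "Inf (T (c \<cdot>\<^sub>v x)) \<le> c * Inf (T x)" if x: "x \<in> carrier_vec n" and c: "0 < c" for x c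
      proof -
        have "Inf (T (c \<cdot>\<^sub>v x)) / c \<le> r" if "r \<in> T x" for r
          using lower[OF _ T_scale[OF that c]] x c by (simp add: field_simps)
        then have "Inf (T (c \<cdot>\<^sub>v x)) / c \<le> Inf (T x)"
          using T_ne[OF x] by (intro cInf_greatest) auto
        then show ?thesis using c by (simp add: field_simps)
      qed
      fix x :: "real vec" and c :: real assume x: "x \<in> carrier_vec n" and c: "0 < c"
      have "Inf (T ((1 / c) \<cdot>\<^sub>v (c \<cdot>\<^sub>v x))) \<le> (1 / c) * Inf (T (c \<cdot>\<^sub>v x))"
        using le[of "c \<cdot>\<^sub>v x" "1 / c"] x c by simp
      then have "c * Inf (T x) \<le> Inf (T (c \<cdot>\<^sub>v x))"
        using c by (simp add: smult_smult_assoc field_simps)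
      with le[OF x c] show "Inf (T (c \<cdot>\<^sub>v x)) = c * Inf (T x)" by simp
    qed
    then obtain a where a: "a \<in> carrier_vec n" "\<And>x. x \<in> carrier_vec n \<Longrightarrow> a \<bullet> x \<le> Inf (T x)"
      by blast
    show ?thesis
    proof (intro bexI[of _ "vCons \<sigma> (- a)"] conjI ballI)
      fix x assume x: "x \<in> K"
      then have "x \<in> carrier_vec (Suc n)" using Suc.prems(1) by blast
      then obtain s y where y: "x = vCons s y" "y \<in> carrier_vec n" by (rule carrier_vec_SucE)
      then have "\<sigma> * s \<in> T y" using x by (auto simp: T_def)
      then have "a \<bullet> y \<le> \<sigma> * s" using a(2)[OF y(2)] lower[OF y(2)] by force
      then show "0 \<le> vCons \<sigma> (- a) \<bullet> x" using a(1) y by simp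
    qed (use a \<sigma> in \<open>auto simp: zero_vec_Suc\<close>)
  qed
qed

text \<open>The cone generated by the differences \<open>x - y\<close> omits the origin because the
  sets are disjoint. With the origin added it is still a proper convex cone, and its supporting
  functional separates.\<close>

lemma separate_disjoint_convex:
  assumes S: "S \<subseteq> carrier_vec n" "vec_convex S" "S \<noteq> {}"
    and T: "T \<subseteq> carrier_vec n" "vec_convex T" "T \<noteq> {}"
    and disj: "S \<inter> T = {}"
  shows "\<exists>a\<in>carrier_vec n. a \<noteq> 0\<^sub>v n \<and> (\<forall>x\<in>S. \<forall>y\<in>T. a \<bullet> y \<le> a \<bullet> x)"
proof -
  define K where "K = {c \<cdot>\<^sub>v (x - y) | c x y. 0 < c \<and> x \<in> S \<and> y \<in> T}"
  have K_carrier: "K \<subseteq> carrier_vec n"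
    using S(1) T(1) by (auto simp: K_def intro!: smult_carrier_vec minus_carrier_vec)
  have K_0: "0\<^sub>v n \<notin> K"
  proof
    assume "0\<^sub>v n \<in> K"
    then obtain c x y where c: "0\<^sub>v n = c \<cdot>\<^sub>v (x - y)" "0 < c" "x \<in> S" "y \<in> T"
      by (auto simp: K_def)
    have dims: "x \<in> carrier_vec n" "y \<in> carrier_vec n" using c S(1) T(1) by auto
    have "x = y"
    proof (rule eq_vecI)
      fix i assume "i < dim_vec y"
      then have "i < n" using dims by simp
      then have "(0\<^sub>v n :: real vec) $ i = c * (x $ i - y $ i)"
        unfolding c(1) using dims by simp
      then show "x $ i = y $ i" using c(2) \<open>i < n\<close> by simp
    qed (use dims in simp)
    then show False using c disj by auto
  qed
  have K_scale: "d \<cdot>\<^sub>v z \<in> K" if "z \<in> K" "0 < d" for z d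
  proof -
    obtain c x y where "z = c \<cdot>\<^sub>v (x - y)" "0 < c" "x \<in> S" "y \<in> T" using \<open>z \<in> K\<close> by (auto simp: K_def)
    then show ?thesis unfolding K_def using that(2)
      by (simp add: smult_smult_assoc) (metis mult_pos_pos)
  qed
  have K_add: "z + z' \<in> K" if "z \<in> K" "z' \<in> K" for z z'
  proof -
    obtain c x y where z: "z = c \<cdot>\<^sub>v (x - y)" "0 < c" "x \<in> S" "y \<in> T"
      using \<open>z \<in> K\<close> by (auto simp: K_def)
    obtain c' x' y' where z': "z' = c' \<cdot>\<^sub>v (x' - y')" "0 < c'" "x' \<in> S" "y' \<in> T"
      using \<open>z' \<in> K\<close> by (auto simp: K_def)
    \<comment> \<open>Normalised weights: a sum of two scaled differences becomes
      \<open>c + c'\<close> times the difference of two convex combinations.\<close>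
    define a where "a = c / (c + c')"
    define b where "b = c' / (c + c')"
    have ab: "0 \<le> a" "0 \<le> b" "a + b = 1"
      using z(2) z'(2) by (auto simp: a_def b_def add_divide_distrib[symmetric])
    have c: "c = (c + c') * a" and c': "c' = (c + c') * b"
      using z(2) z'(2) by (auto simp: a_def b_def)
    have "a \<cdot>\<^sub>v x + b \<cdot>\<^sub>v x' \<in> S" using S(2) ab z(3) z'(3) unfolding vec_convex_def by blast
    moreover have "a \<cdot>\<^sub>v y + b \<cdot>\<^sub>v y' \<in> T" using T(2) ab z(4) z'(4) unfolding vec_convex_def by blast
    moreover have "z + z' = (c + c') \<cdot>\<^sub>v ((a \<cdot>\<^sub>v x + b \<cdot>\<^sub>v x') - (a \<cdot>\<^sub>v y + b \<cdot>\<^sub>v y'))"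
    proof -
      have "x \<in> carrier_vec n" "y \<in> carrier_vec n" "x' \<in> carrier_vec n" "y' \<in> carrier_vec n"
        using z(3,4) z'(3,4) S(1) T(1) by auto
      then show ?thesis
        unfolding z(1) z'(1)
        by (intro eq_vecI) (auto simp: c[symmetric] c'[symmetric] right_diff_distrib distrib_left
            mult.assoc[symmetric])
    qed
    moreover have "0 < c + c'" using z(2) z'(2) by simp
    ultimately show ?thesis unfolding K_def by blast
  qed
  obtain z where z: "z \<in> K" using S(3) T(3) by (force simp: K_def intro: exI[of _ "1::real"])
  have "\<exists>a\<in>carrier_vec n. a \<noteq> 0\<^sub>v n \<and> (\<forall>x\<in>insert (0\<^sub>v n) K. 0 \<le> a \<bullet> x)"
  proof (rule convex_cone_supporting_functional)
    have zc: "z \<in> carrier_vec n" using z K_carrier by auto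
    \<comment> \<open>Properness of the cone: \<open>z\<close> and \<open>- z\<close> together would
      add up to the excluded origin.\<close>
    have "- z \<notin> insert (0\<^sub>v n) K"
    proof
      assume "- z \<in> insert (0\<^sub>v n) K"
      moreover have "z + - z = 0\<^sub>v n" using zc by auto
      ultimately have "- z = 0\<^sub>v n" using K_add[OF z, of "- z"] K_0 by auto
      then have "z = 0\<^sub>v n" using \<open>z + - z = 0\<^sub>v n\<close> zc by simp
      then show False using z K_0 by simp
    qed
    then show "insert (0\<^sub>v n) K \<subset> carrier_vec n" using K_carrier zc by auto
    show "x + y \<in> insert (0\<^sub>v n) K" if "x \<in> insert (0\<^sub>v n) K" "y \<in> insert (0\<^sub>v n) K" for x y
      using that K_carrier K_add by auto
    show "c \<cdot>\<^sub>v x \<in> insert (0\<^sub>v n) K" if "x \<in> insert (0\<^sub>v n) K" "0 < c" for x and c :: real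
      using that K_scale by auto
  qed auto
  then obtain a where a: "a \<in> carrier_vec n" "a \<noteq> 0\<^sub>v n" "\<And>x. x \<in> K \<Longrightarrow> 0 \<le> a \<bullet> x" by auto
  have "a \<bullet> y \<le> a \<bullet> x" if "x \<in> S" "y \<in> T" for x y
  proof -
    have "x - y \<in> K" unfolding K_def using that
      by (intro CollectI exI[of _ "1::real"] exI[of _ x] exI[of _ y]) simp
    then have "0 \<le> a \<bullet> (x - y)" by (rule a(3))
    also have "\<dots> = a \<bullet> x - a \<bullet> y" using a(1) that S(1) T(1) by (intro scalar_prod_minus_distrib) auto
    finally show ?thesis by simp
  qed
  then show ?thesis using a by blast
qed

section \<open>Linear inequalities\<close>

text \<open>A pair \<open>(r, w)\<close> stands for the inequality
  \<open>r \<bullet> x \<le> w\<close>, and the set collects its consequences by nonnegative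
  combination. A member \<open>(0, w)\<close> with \<open>w < 0\<close> is a certificate of
  inconsistency.\<close>

inductive_set inequality_cone :: "nat \<Rightarrow> (real vec \<times> real) set \<Rightarrow> (real vec \<times> real) set"
  for n S where
    zero: "(0\<^sub>v n, 0) \<in> inequality_cone n S"
  | add: "(r, w) \<in> S \<Longrightarrow> 0 \<le> a \<Longrightarrow> (r', w') \<in> inequality_cone n S \<Longrightarrow>
      (a \<cdot>\<^sub>v r + r', a * w + w') \<in> inequality_cone n S"

lemma inequality_cone_carrier:
  assumes S: "fst ` S \<subseteq> carrier_vec n" and z: "(r, w) \<in> inequality_cone n S"
  shows "r \<in> carrier_vec n"
  using z
proof (induction r w rule: inequality_cone.induct)
  case (add r w a r' w')
  then have "r \<in> carrier_vec n" using S by force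
  then show ?case using add.IH by simp
qed simp

lemma inequality_cone_plus:
  assumes S: "fst ` S \<subseteq> carrier_vec n"
    and z: "(r, w) \<in> inequality_cone n S" and z': "(r', w') \<in> inequality_cone n S"
  shows "(r + r', w + w') \<in> inequality_cone n S"
  using z
proof (induction r w rule: inequality_cone.induct)
  case zero
  then show ?case using z' inequality_cone_carrier[OF S z'] by simp
next
  case (add r0 w0 a r1 w1)
  have "r0 \<in> carrier_vec n" "r1 \<in> carrier_vec n" "r' \<in> carrier_vec n"
    using S add.hyps inequality_cone_carrier[OF S] z' by force+
  then have "a \<cdot>\<^sub>v r0 + r1 + r' = a \<cdot>\<^sub>v r0 + (r1 + r')" by auto
  then show ?case
    using inequality_cone.add[OF add.hyps(1,2) add.IH] by (simp add: add.assoc)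
qed

lemma inequality_cone_scale:
  assumes S: "fst ` S \<subseteq> carrier_vec n" and z: "(r, w) \<in> inequality_cone n S" and c: "0 \<le> c"
  shows "(c \<cdot>\<^sub>v r, c * w) \<in> inequality_cone n S"
  using z
proof (induction r w rule: inequality_cone.induct)
  case zero
  have "c \<cdot>\<^sub>v 0\<^sub>v n = 0\<^sub>v n" by auto
  then show ?case using inequality_cone.zero by simp
next
  case (add r0 w0 a r1 w1)
  have "r0 \<in> carrier_vec n" "r1 \<in> carrier_vec n"
    using S add.hyps inequality_cone_carrier[OF S] by force+
  then have "c \<cdot>\<^sub>v (a \<cdot>\<^sub>v r0 + r1) = (c * a) \<cdot>\<^sub>v r0 + c \<cdot>\<^sub>v r1"
    by (auto simp: smult_add_distrib_vec smult_smult_assoc)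
  then show ?case
    using inequality_cone.add[OF add.hyps(1) _ add.IH, of "c * a"] add.hyps(2) c
    by (simp add: algebra_simps)
qed

lemma inequality_cone_base:
  assumes S: "fst ` S \<subseteq> carrier_vec n" and z: "(r, w) \<in> S"
  shows "(r, w) \<in> inequality_cone n S"
proof -
  have "r \<in> carrier_vec n" using assms by force
  then show ?thesis
    using inequality_cone.add[OF z zero_le_one inequality_cone.zero[of n S]] by simp
qed

text \<open>The cases with an empty side are split off because \<open>Min\<close> and
  \<open>Max\<close> say nothing about the empty set.\<close>

lemma finite_between:
  fixes L U :: "real set"
  assumes "finite L" "finite U" "\<And>l u. l \<in> L \<Longrightarrow> u \<in> U \<Longrightarrow> l \<le> u"
  obtains t where "\<And>l. l \<in> L \<Longrightarrow> l \<le> t" "\<And>u. u \<in> U \<Longrightarrow> t \<le> u"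
proof (cases "L = {}")
  case True
  show ?thesis
  proof (cases "U = {}")
    case False
    then show ?thesis using True assms(2) by (intro that[of "Min U"]) auto
  qed (use True that in blast)
next
  case False
  then show ?thesis using assms by (intro that[of "Max L"]) auto
qed

text \<open>Eliminating the first coordinate keeps the inequalities free of it and pairs each upper
  bound on it with each lower bound. The new inequalities are consequences of the old ones, so no
  contradiction appears, and a solution of the smaller system leaves room for the eliminated
  coordinate.\<close>

lemma fourier_motzkin:
  fixes S :: "(real vec \<times> real) set"
  assumes "finite S" "fst ` S \<subseteq> carrier_vec n"
    and "\<And>w. (0\<^sub>v n, w) \<in> inequality_cone n S \<Longrightarrow> 0 \<le> w"
  shows "\<exists>x\<in>carrier_vec n. \<forall>(r, w)\<in>S. r \<bullet> x \<le> w"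
  using assms
proof (induction n arbitrary: S)
  case 0
  have "r \<bullet> 0\<^sub>v 0 \<le> w" if "(r, w) \<in> S" for r w
  proof -
    have "r \<in> carrier_vec 0" using 0(2) that by force
    then have "r = 0\<^sub>v 0" by (intro carrier_vec_0_eq) auto
    then have "0 \<le> w" using 0(3) inequality_cone_base[OF 0(2) that] by simp
    then show ?thesis using \<open>r \<in> carrier_vec 0\<close> by (auto simp: scalar_prod_def)
  qed
  then show ?case by (intro bexI[of _ "0\<^sub>v 0"]) (auto simp del: zero_vec_zero)
next
  case (Suc n)
  note S = Suc.prems(2)
  \<comment> \<open>The factors \<open>1 / \<alpha>\<close> and \<open>1 / - \<beta>\<close> are
    positive for \<alpha> > 0 > \<beta> and turn the leading coefficients into 1 and -1, which
    cancel.\<close>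
  define comb where "comb = (\<lambda>((\<alpha> :: real, r, w), (\<beta>, r', w')).
      ((1 / \<alpha>) \<cdot>\<^sub>v r + (1 / - \<beta>) \<cdot>\<^sub>v r', (1 / \<alpha>) * w + (1 / - \<beta>) * w'))"
  define split where "split = (\<lambda>(r :: real vec, w :: real). (r $ 0, Matrix.vec n (\<lambda>i. r $ Suc i), w))"
  define Z where "Z = snd ` {z \<in> split ` S. fst z = 0}"
  define Po where "Po = {z \<in> split ` S. 0 < fst z}"
  define Ne where "Ne = {z \<in> split ` S. fst z < 0}"
  define S' where "S' = Z \<union> comb ` (Po \<times> Ne)"
  have split_in: "(vCons \<alpha> r, w) \<in> S \<and> r \<in> carrier_vec n" if "(\<alpha>, r, w) \<in> split ` S" for \<alpha> r w
  proof -
    obtain q where q: "(q, w) \<in> S" "\<alpha> = q $ 0" "r = Matrix.vec n (\<lambda>i. q $ Suc i)"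
      using \<open>(\<alpha>, r, w) \<in> split ` S\<close> by (auto simp: split_def)
    then have "q \<in> carrier_vec (Suc n)" using S by force
    then have "vCons \<alpha> r = q"
      unfolding q by (intro eq_vecI) (auto simp: vec_index_vCons)
    then show ?thesis using q by auto
  qed
  have in_split: "(\<alpha>, r, w) \<in> split ` S" if "(vCons \<alpha> r, w) \<in> S" for \<alpha> r w
  proof -
    have "vCons \<alpha> r \<in> carrier_vec (Suc n)" using S that by force
    then have "split (vCons \<alpha> r, w) = (\<alpha>, r, w)" by (auto simp: split_def)
    then show ?thesis using that by force
  qed
  have S'_sub: "r \<in> carrier_vec n \<and> (vCons 0 r, w) \<in> inequality_cone (Suc n) S"
    if "(r, w) \<in> S'" for r w
    using that unfolding S'_def
  proof
    assume "(r, w) \<in> Z"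
    then obtain z where z: "z \<in> {z \<in> split ` S. fst z = 0}" and rw: "(r, w) = snd z"
      unfolding Z_def by (rule imageE)
    have "z = (0, r, w)" using z rw by (cases z) simp
    with z have "(0, r, w) \<in> split ` S" by (simp only: mem_Collect_eq)
    from split_in[OF this] show ?thesis using inequality_cone_base[OF S] by blast
  next
    assume "(r, w) \<in> comb ` (Po \<times> Ne)"
    then obtain z1 z2 where z: "z1 \<in> Po" "z2 \<in> Ne" "(r, w) = comb (z1, z2)" by blast
    obtain \<alpha> r1 w1 where z1: "z1 = (\<alpha>, r1, w1)" by (rule prod_cases3)
    obtain \<beta> r2 w2 where z2: "z2 = (\<beta>, r2, w2)" by (rule prod_cases3)
    have
      1: "(\<alpha>, r1, w1) \<in> split ` S" "0 < \<alpha>" and 2: "(\<beta>, r2, w2) \<in> split ` S" "\<beta> < 0"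
      and r: "r = (1 / \<alpha>) \<cdot>\<^sub>v r1 + (1 / - \<beta>) \<cdot>\<^sub>v r2" "w = (1 / \<alpha>) * w1 + (1 / - \<beta>) * w2"
      using z unfolding z1 z2 by (auto simp: comb_def Po_def Ne_def)
    note c1 = split_in[OF 1(1)] and c2 = split_in[OF 2(1)]
    have "((1 / \<alpha>) \<cdot>\<^sub>v vCons \<alpha> r1 + (1 / - \<beta>) \<cdot>\<^sub>v vCons \<beta> r2, w) \<in> inequality_cone (Suc n) S"
      unfolding r(2) using c1 c2 1(2) 2(2)
      by (intro inequality_cone_plus inequality_cone_scale S inequality_cone_base) auto
    moreover have d: "dim_vec r1 = n" "dim_vec r2 = n" using c1 c2 by auto
    have "(1 / \<alpha>) \<cdot>\<^sub>v vCons \<alpha> r1 + (1 / - \<beta>) \<cdot>\<^sub>v vCons \<beta> r2 = vCons 0 r"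
      using d 1(2) 2(2) by (simp add: r(1) vCons_smult vCons_add)
    ultimately show ?thesis using c1 c2 r(1) by simp
  qed
  have S': "fst ` S' \<subseteq> carrier_vec n" using S'_sub by force
  \<comment> \<open>This passes the consistency hypothesis down: a contradiction derived after
    elimination would be one for the original system.\<close>
  have lift: "(vCons 0 r, w) \<in> inequality_cone (Suc n) S" if "(r, w) \<in> inequality_cone n S'" for r w
    using that
  proof (induction r w rule: inequality_cone.induct)
    case zero
    then show ?case using inequality_cone.zero[of "Suc n" S] by (simp add: zero_vec_Suc)
  next
    case (add r w a r' w')
    have "dim_vec r = n" "dim_vec r' = n"
      using S'_sub[OF add.hyps(1)] inequality_cone_carrier[OF S' add.hyps(3)] by auto
    then have "vCons 0 (a \<cdot>\<^sub>v r + r') = a \<cdot>\<^sub>v vCons 0 r + vCons 0 r'"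
      by (simp add: vCons_smult vCons_add)
    then show ?case
      using inequality_cone_plus[OF S inequality_cone_scale[OF S _ add.hyps(2)] add.IH]
        S'_sub[OF add.hyps(1)] by simp
  qed
  have "\<exists>x\<in>carrier_vec n. \<forall>(r, w)\<in>S'. r \<bullet> x \<le> w"
  proof (rule Suc.IH[OF _ S'])
    show "finite S'" unfolding S'_def Z_def Po_def Ne_def using Suc.prems(1) by auto
    show "0 \<le> w" if "(0\<^sub>v n, w) \<in> inequality_cone n S'" for w
      using Suc.prems(3) lift[OF that] by (simp add: zero_vec_Suc)
  qed
  then obtain x where x: "x \<in> carrier_vec n" "\<And>r w. (r, w) \<in> S' \<Longrightarrow> r \<bullet> x \<le> w" by blast
  \<comment> \<open>The value of the first coordinate at which the inequality becomes tight: an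
    upper bound when \<alpha> > 0, a lower bound when \<alpha> < 0.\<close>
  define bound where "bound = (\<lambda>(\<alpha>, r, w). (w - r \<bullet> x) / \<alpha>)"
  have between: "l \<le> u" if lu: "l \<in> bound ` Ne" "u \<in> bound ` Po" for l u
  proof -
    from lu obtain z1 z2 where z: "z1 \<in> Po" "z2 \<in> Ne" "u = bound z1" "l = bound z2" by blast
    obtain \<alpha> r1 w1 where z1: "z1 = (\<alpha>, r1, w1)" by (rule prod_cases3)
    obtain \<beta> r2 w2 where z2: "z2 = (\<beta>, r2, w2)" by (rule prod_cases3)
    have
      1: "(\<alpha>, r1, w1) \<in> Po" "u = (w1 - r1 \<bullet> x) / \<alpha>" and
      2: "(\<beta>, r2, w2) \<in> Ne" "l = (w2 - r2 \<bullet> x) / \<beta>"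
      using z unfolding z1 z2 by (auto simp: bound_def)
    have "r1 \<in> carrier_vec n" "r2 \<in> carrier_vec n" using 1 2 split_in by (auto simp: Po_def Ne_def)
    moreover have "comb ((\<alpha>, r1, w1), (\<beta>, r2, w2)) \<in> S'" using 1 2 by (auto simp: S'_def)
    ultimately have "(1 / \<alpha>) * (r1 \<bullet> x) + (1 / - \<beta>) * (r2 \<bullet> x) \<le> (1 / \<alpha>) * w1 + (1 / - \<beta>) * w2"
      using x by (auto simp: comb_def add_scalar_prod_distrib[of _ n] dest!: x(2))
    then show ?thesis unfolding 1 2 by (simp add: diff_divide_distrib)
  qed
  have "finite (bound ` Ne)" "finite (bound ` Po)"
    unfolding Po_def Ne_def using Suc.prems(1) by auto
  then obtain t where t: "\<And>l. l \<in> bound ` Ne \<Longrightarrow> l \<le> t" "\<And>u. u \<in> bound ` Po \<Longrightarrow> t \<le> u"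
    using finite_between[OF _ _ between] by blast
  show ?case
  proof (intro bexI[of _ "vCons t x"] ballI, clarify)
    fix q w assume "(q, w) \<in> S"
    moreover then have "q \<in> carrier_vec (Suc n)" using S by force
    then obtain \<alpha> r where q: "q = vCons \<alpha> r" "r \<in> carrier_vec n" by (rule carrier_vec_SucE)
    ultimately have m: "(\<alpha>, r, w) \<in> split ` S" using in_split by simp
    have "\<alpha> * t + r \<bullet> x \<le> w"
    proof (cases \<alpha> "0::real" rule: linorder_cases)
      case less
      then have "(\<alpha>, r, w) \<in> Ne" using m by (auto simp: Ne_def)
      then have "(w - r \<bullet> x) / \<alpha> \<le> t" using t(1) by (force simp: bound_def)
      then show ?thesis using less by (simp add: field_simps)
    next
      case equal
      then have "(\<alpha>, r, w) \<in> {z \<in> split ` S. fst z = 0}" using m by simp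
      from imageI[OF this, of snd] have "(r, w) \<in> S'" by (simp add: S'_def Z_def)
      then show ?thesis using x(2) equal by simp
    next
      case greater
      then have "(\<alpha>, r, w) \<in> Po" using m by (auto simp: Po_def)
      then have "t \<le> (w - r \<bullet> x) / \<alpha>" using t(2) by (force simp: bound_def)
      then show ?thesis using greater by (simp add: field_simps)
    qed
    then show "q \<bullet> vCons t x \<le> w" by (simp add: q)
  qed (use x in simp)
qed

text \<open>A derivation in \<open>inequality_cone\<close> records its multipliers: each consequence
  of the rows has the form \<open>(transpose_mat D *\<^sub>v y, y \<bullet> w)\<close> with
  \<open>y\<close> nonnegative, so \<open>cert\<close> rules out contradictions.\<close>

lemma farkas:
  fixes D :: "real mat"
  assumes D: "D \<in> carrier_mat m n" and w: "w \<in> carrier_vec m"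
    and cert: "\<And>y. y \<in> carrier_vec m \<Longrightarrow> 0\<^sub>v m \<le> y \<Longrightarrow> transpose_mat D *\<^sub>v y = 0\<^sub>v n \<Longrightarrow> 0 \<le> y \<bullet> w"
  shows "\<exists>x\<in>carrier_vec n. D *\<^sub>v x \<le> w"
proof -
  define S where "S = (\<lambda>i. (row D i, w $ i)) ` {..<m}"
  have S: "fst ` S \<subseteq> carrier_vec n" using D by (auto simp: S_def)
  have mult: "\<exists>y\<in>carrier_vec m. 0\<^sub>v m \<le> y \<and> r = transpose_mat D *\<^sub>v y \<and> b = y \<bullet> w"
    if "(r, b) \<in> inequality_cone n S" for r b
    using that
  proof (induction r b rule: inequality_cone.induct)
    case zero
    then show ?case using D w by (intro bexI[of _ "0\<^sub>v m"]) auto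
  next
    case (add r b a r' b')
    then obtain i where i: "i < m" "r = row D i" "b = w $ i" by (auto simp: S_def)
    obtain y where y: "y \<in> carrier_vec m" "0\<^sub>v m \<le> y" "r' = transpose_mat D *\<^sub>v y" "b' = y \<bullet> w"
      using add.IH by blast
    have e: "transpose_mat D *\<^sub>v unit_vec m i = row D i"
      using D i by (intro eq_vecI) auto
    have "transpose_mat D *\<^sub>v (a \<cdot>\<^sub>v unit_vec m i + y) = a \<cdot>\<^sub>v r + r'"
      using D y i(2) e by (simp add: mult_add_distrib_mat_vec[of _ n m] mult_mat_vec[of _ n m])
    moreover have "(a \<cdot>\<^sub>v unit_vec m i + y) \<bullet> w = a * b + b'"
      using w y i by (simp add: add_scalar_prod_distrib[of _ m])
    moreover have "0\<^sub>v m \<le> a \<cdot>\<^sub>v unit_vec m i + y"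
      using y add.hyps(2) by (auto simp: less_eq_vec_def unit_vec_def)
    ultimately show ?case using y(1) by (intro bexI[of _ "a \<cdot>\<^sub>v unit_vec m i + y"]) auto
  qed
  have "\<exists>x\<in>carrier_vec n. \<forall>(r, b)\<in>S. r \<bullet> x \<le> b"
  proof (rule fourier_motzkin[OF _ S])
    show "finite S" by (simp add: S_def)
    show "0 \<le> b" if "(0\<^sub>v n, b) \<in> inequality_cone n S" for b
      using mult[OF that] cert by metis
  qed
  then show ?thesis using D w by (auto simp: S_def less_eq_vec_def)
qed

section \<open>Essential strict feasibility\<close>

lemma minus_append_vec:
  fixes a b c d :: "real vec"
  assumes "a \<in> carrier_vec m" "c \<in> carrier_vec m" "b \<in> carrier_vec n" "d \<in> carrier_vec n"
  shows "(a @\<^sub>v b) - (c @\<^sub>v d) = (a - c) @\<^sub>v (b - d)"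
  using assms by (intro eq_vecI) auto

lemma carrier_vec_addE:
  assumes "v \<in> carrier_vec (m + n)"
  obtains a b where "v = a @\<^sub>v b" "a \<in> carrier_vec m" "b \<in> carrier_vec n"
  using vec_first_last_append[OF assms] by (metis vec_first_carrier vec_last_carrier)

lemma transpose_append_rows_mult:
  fixes A B :: "real mat"
  assumes A: "A \<in> carrier_mat m k" and B: "B \<in> carrier_mat n k"
    and y: "y \<in> carrier_vec m" and z: "z \<in> carrier_vec n"
  shows "transpose_mat (A @\<^sub>r B) *\<^sub>v (y @\<^sub>v z) = transpose_mat A *\<^sub>v y + transpose_mat B *\<^sub>v z"
proof (rule eq_vecI)
  have AB: "A @\<^sub>r B \<in> carrier_mat (m + n) k" using A B by (rule carrier_append_rows)
  fix j assume j: "j < dim_vec (transpose_mat A *\<^sub>v y + transpose_mat B *\<^sub>v z)"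
  then have j: "j < k" using B by simp
  have "col (A @\<^sub>r B) j = col A j @\<^sub>v col B j"
    using A B j by (intro eq_vecI) (auto simp: append_rows_def)
  then show "(transpose_mat (A @\<^sub>r B) *\<^sub>v (y @\<^sub>v z)) $ j
      = (transpose_mat A *\<^sub>v y + transpose_mat B *\<^sub>v z) $ j"
    using A B y z j scalar_prod_append[of "col A j" m "col B j" n y z]
      carrier_matD[OF AB] by simp
qed (use A B in \<open>auto simp: append_rows_def\<close>)

lemma transpose_row_mult:
  fixes v y :: "real vec"
  assumes v: "v \<in> carrier_vec n" and y: "y \<in> carrier_vec 1"
  shows "transpose_mat (mat_of_row v) *\<^sub>v y = (y $ 0) \<cdot>\<^sub>v v"
  using assms by (intro eq_vecI) (auto simp: scalar_prod_def mat_of_row_def)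

lemma scalar_prod_nonneg:
  fixes x y :: "real vec"
  assumes "0\<^sub>v n \<le> x" "0\<^sub>v n \<le> y"
  shows "0 \<le> x \<bullet> y"
  using assms by (auto simp: less_eq_vec_def scalar_prod_def intro!: sum_nonneg)

lemma scalar_prod_self_pos:
  fixes x :: "real vec"
  assumes "x \<in> carrier_vec n" "x \<noteq> 0\<^sub>v n"
  shows "0 < x \<bullet> x"
proof -
  have "\<exists>i<n. x $ i \<noteq> 0"
  proof (rule ccontr)
    assume "\<not> ?thesis"
    then have "x = 0\<^sub>v n" using assms(1) by (intro eq_vecI) auto
    with assms(2) show False by simp
  qed
  then obtain i where i: "i < n" "x $ i \<noteq> 0" by blast
  have "0 < (\<Sum>j\<in>{0..<n}. x $ j * x $ j)"
    using i by (intro sum_pos2[of _ i]) (auto simp: zero_less_mult_iff)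
  then show ?thesis using assms(1) by (simp add: scalar_prod_def)
qed

section \<open>Interior points and compactness in coordinate space\<close>

lemma interior_of_euclid_direction:
  assumes z: "z \<in> euclid n interior_of K" and d: "d \<in> carrier_vec n"
  shows "\<exists>\<epsilon>>0. z + \<epsilon> \<cdot>\<^sub>v d \<in> K"
proof -
  obtain U where U: "openin (euclid n) U" "z \<in> U" "U \<subseteq> K"
    using z by (auto simp: interior_of_def)
  have zc: "z \<in> carrier_vec n"
    using openin_subset[OF U(1)] U(2) by (auto simp: euclid_def topspace_pullback_topology)
  \<comment> \<open>The line through \<open>z\<close> in direction \<open>d\<close> is continuous,
    so it stays in the open neighbourhood for all small parameters.\<close>
  let ?g = "\<lambda>s. z + s \<cdot>\<^sub>v d"
  have "(\<lambda>v i. if i < n then v $ i else 0) \<circ> ?g = (\<lambda>s i. if i < n then z $ i + s * d $ i else 0)"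
    using zc d by (auto simp: fun_eq_iff)
  moreover have "continuous_map euclideanreal (Euclidean_space n)
      (\<lambda>s i. if i < n then z $ i + s * d $ i else 0)"
    unfolding continuous_map_componentwise_Euclidean_space
    by (auto intro!: continuous_intros)
  ultimately have "continuous_map euclideanreal (euclid n) ?g"
    unfolding euclid_def using zc d by (intro continuous_map_pullback') auto
  from openin_continuous_map_preimage[OF this U(1)] have "open {s. ?g s \<in> U}" by simp
  moreover have "?g 0 = z" using zc d by (intro eq_vecI) auto
  then have "0 \<in> {s. ?g s \<in> U}" using U(2) by simp
  ultimately obtain e where e: "0 < e" "ball 0 e \<subseteq> {s. ?g s \<in> U}"
    unfolding open_contains_ball by blast
  then have "e / 2 \<in> {s. ?g s \<in> U}" by (intro subsetD[OF e(2)]) auto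
  then show ?thesis using U(3) e(1) by (intro exI[of _ "e / 2"]) auto
qed

text \<open>An interior point can be moved a little along \<open>- a\<close> without leaving the
  cone. The pairing with \<open>a\<close> is still nonnegative there, although it has dropped by a
  positive multiple of \<open>a \<bullet> a\<close>.\<close>

lemma dual_cone_interior_pos:
  assumes a: "a \<in> dual_cone n K" "a \<noteq> 0\<^sub>v n" and q: "q \<in> euclid n interior_of K"
  shows "0 < a \<bullet> q"
proof -
  have ac: "a \<in> carrier_vec n" using a by (simp add: dual_cone_def)
  have qc: "q \<in> carrier_vec n"
    using subsetD[OF interior_of_subset_topspace q] by (auto simp: euclid_def topspace_pullback_topology)
  obtain \<epsilon> where \<epsilon>: "0 < \<epsilon>" "q + \<epsilon> \<cdot>\<^sub>v (- a) \<in> K"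
    using interior_of_euclid_direction[OF q, of "- a"] ac by auto
  have "0 \<le> a \<bullet> (q + \<epsilon> \<cdot>\<^sub>v (- a))" using a(1) \<epsilon>(2) by (simp add: dual_cone_def)
  also have "\<dots> = a \<bullet> q - \<epsilon> * (a \<bullet> a)"
    using ac qc by (simp add: scalar_prod_add_distrib[of _ n])
  finally show ?thesis using mult_pos_pos[OF \<epsilon>(1) scalar_prod_self_pos[OF ac a(2)]] by simp
qed

lemma compactin_euclid_coordinate_bounded:
  assumes Y: "compactin (euclid n) Y" and i: "i < n"
  shows "\<exists>B. \<forall>y\<in>Y. \<bar>y $ i\<bar> \<le> B"
proof -
  have "continuous_map (Euclidean_space n) euclideanreal (\<lambda>f. f i)"
    unfolding Euclidean_space_def
    by (rule continuous_map_from_subtopology[OF continuous_map_product_projection]) simp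
  from continuous_map_pullback[OF this, of "carrier_vec n" "\<lambda>v i. if i < n then v $ i else 0"]
  have "continuous_map (euclid n) euclideanreal (\<lambda>v. v $ i)"
    using i by (simp add: euclid_def o_def)
  from image_compactin[OF Y this] have "bounded ((\<lambda>v. v $ i) ` Y)"
    by (simp add: compact_imp_bounded)
  then show ?thesis by (auto simp: bounded_iff)
qed

text \<open>Keeps affine majorants of \<psi> bounded on \<open>Y\<close>, so that the supremum in
  \<open>Psi_bar\<close> is a genuine one.\<close>

lemma compactin_euclid_scalar_prod_bounded:
  assumes Y: "compactin (euclid n) Y" "Y \<subseteq> carrier_vec n"
  shows "\<exists>B. \<forall>y\<in>Y. f \<bullet> y \<le> B"
proof -
  obtain b where b: "\<And>i y. i < n \<Longrightarrow> y \<in> Y \<Longrightarrow> \<bar>y $ i\<bar> \<le> b i"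
    using compactin_euclid_coordinate_bounded[OF Y(1)] by metis
  have "f \<bullet> y \<le> (\<Sum>i\<in>{0..<n}. \<bar>f $ i\<bar> * b i)" if y: "y \<in> Y" for y
  proof -
    have "f \<bullet> y = (\<Sum>i\<in>{0..<n}. f $ i * y $ i)" using y Y(2) by (auto simp: scalar_prod_def)
    also have "\<dots> \<le> (\<Sum>i\<in>{0..<n}. \<bar>f $ i\<bar> * b i)"
    proof (rule sum_mono)
      fix i assume "i \<in> {0..<n}"
      then have "\<bar>f $ i * y $ i\<bar> \<le> \<bar>f $ i\<bar> * b i"
        using b[OF _ y] by (auto simp: abs_mult intro: mult_left_mono)
      then show "f $ i * y $ i \<le> \<bar>f $ i\<bar> * b i" by linarith
    qed
    finally show ?thesis .
  qed
  then show ?thesis by blast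
qed

lemma compactin_euclid_recession:
  assumes Y: "compactin (euclid n) Y" and y: "y \<in> carrier_vec n" and a: "a \<in> carrier_vec n"
    and ray: "\<And>s. 0 < s \<Longrightarrow> y + s \<cdot>\<^sub>v a \<in> Y"
  shows "a = 0\<^sub>v n"
proof (rule eq_vecI)
  fix i assume "i < dim_vec (0\<^sub>v n :: real vec)"
  then have i: "i < n" by simp
  obtain B where B: "\<And>y. y \<in> Y \<Longrightarrow> \<bar>y $ i\<bar> \<le> B"
    using compactin_euclid_coordinate_bounded[OF Y i] by blast
  have *: "\<bar>y $ i + s * a $ i\<bar> \<le> B" if "0 < s" for s
    using B[OF ray[OF that]] y a i by simp
  have "a $ i = 0"
  proof (rule ccontr)
    assume ai: "a $ i \<noteq> 0"
    \<comment> \<open>Chosen so that the displacement in coordinate \<open>i\<close> is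
      \<open>\<bar>B\<bar> + \<bar>y $ i\<bar> + 1\<close>, which the starting value cannot bring
      back within \<open>B\<close>.\<close>
    let ?s = "(\<bar>B\<bar> + \<bar>y $ i\<bar> + 1) / \<bar>a $ i\<bar>"
    have s: "0 < ?s" using ai by (intro divide_pos_pos) auto
    have "\<bar>?s * a $ i\<bar> = \<bar>B\<bar> + \<bar>y $ i\<bar> + 1" using ai s by (simp add: abs_mult)
    then show False using *[OF s] by linarith
  qed
  then show "a $ i = 0\<^sub>v n $ i" using i by simp
qed (use a in simp)

text \<open>
  The strictly feasible pair \<open>(v, q)\<close> of slacks makes the certificate strictly positive on every
  multiplier with nonzero \<open>L\<close>-part. This replaces the closedness of \<open>K + im D\<close>, which fails in
  general. Farkas' lemma handles the polyhedral part, where \<open>v\<close> may lie on the boundary.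
\<close>

lemma slater_feasible:
  fixes D1 D2 :: "real mat"
  assumes L: "regular_cone l L"
    and D1: "D1 \<in> carrier_mat m n" and D2: "D2 \<in> carrier_mat l n"
    and w1: "w1 \<in> carrier_vec m" and w2: "w2 \<in> carrier_vec l"
    and v: "v \<in> carrier_vec m" "0\<^sub>v m \<le> v" and q: "q \<in> euclid l interior_of L" and \<delta>: "0 < \<delta>"
    and cert: "\<And>y1 y2. y1 \<in> carrier_vec m \<Longrightarrow> 0\<^sub>v m \<le> y1 \<Longrightarrow> y2 \<in> dual_cone l L \<Longrightarrow>
        transpose_mat D1 *\<^sub>v y1 + transpose_mat D2 *\<^sub>v y2 = 0\<^sub>v n \<Longrightarrow>
        \<delta> * (y1 \<bullet> v + y2 \<bullet> q) \<le> y1 \<bullet> w1 + y2 \<bullet> w2"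
  shows "\<exists>x\<in>carrier_vec n. D1 *\<^sub>v x \<le> w1 \<and> w2 - D2 *\<^sub>v x \<in> L"
proof (rule ccontr)
  assume no: "\<not> ?thesis"
  have Lc: "L \<subseteq> carrier_vec l" and L_conv: "vec_convex L"
    using L unfolding regular_cone_def by blast+
  have L_scale: "a \<cdot>\<^sub>v x \<in> L" if "x \<in> L" "0 \<le> a" for x a
    using L that unfolding regular_cone_def by blast
  have qL: "q \<in> L" by (rule subsetD[OF interior_of_subset q])
  have qc: "q \<in> carrier_vec l" using qL Lc by auto
  have "0 \<cdot>\<^sub>v q = 0\<^sub>v l" using qc by (intro eq_vecI) auto
  then have L0: "0\<^sub>v l \<in> L" using L_scale[OF qL, of 0] by simp
  \<comment> \<open>The polyhedral part alone is solvable: the certificate with zero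
    \<open>L\<close>-part is the hypothesis of Farkas' lemma, since \<open>y \<bullet> v\<close> is
    nonnegative.\<close>
  have "\<exists>x\<in>carrier_vec n. D1 *\<^sub>v x \<le> w1"
  proof (rule farkas[OF D1 w1])
    fix y assume y: "y \<in> carrier_vec m" "0\<^sub>v m \<le> y" "transpose_mat D1 *\<^sub>v y = 0\<^sub>v n"
    have "0\<^sub>v l \<in> dual_cone l L" using Lc by (auto simp: dual_cone_def)
    moreover have "transpose_mat D2 *\<^sub>v 0\<^sub>v l = 0\<^sub>v n" using D2 by auto
    ultimately have "\<delta> * (y \<bullet> v + 0\<^sub>v l \<bullet> q) \<le> y \<bullet> w1 + 0\<^sub>v l \<bullet> w2"
      using y by (intro cert) auto
    moreover have "0 \<le> \<delta> * (y \<bullet> v)" using \<delta> scalar_prod_nonneg[OF y(2) v(2)] by simp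
    ultimately show "0 \<le> y \<bullet> w1" using qc w2 by simp
  qed
  then obtain x0 where x0: "x0 \<in> carrier_vec n" "D1 *\<^sub>v x0 \<le> w1" by blast
  \<comment> \<open>The \<open>L\<close>-slacks that solutions of the polyhedral part can reach.
    Infeasibility means that none of them lies in \<open>L\<close>.\<close>
  define S where "S = {w2 - D2 *\<^sub>v x | x. x \<in> carrier_vec n \<and> D1 *\<^sub>v x \<le> w1}"
  have "\<exists>a\<in>carrier_vec l. a \<noteq> 0\<^sub>v l \<and> (\<forall>x\<in>L. \<forall>y\<in>S. a \<bullet> y \<le> a \<bullet> x)"
  proof (rule separate_disjoint_convex[OF Lc L_conv])
    show "L \<noteq> {}" using L0 by blast
    show "S \<subseteq> carrier_vec l" using D2 w2 by (auto simp: S_def)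
    show "S \<noteq> {}" using x0 by (auto simp: S_def)
    show "L \<inter> S = {}" using no by (auto simp: S_def)
    show "vec_convex S" unfolding vec_convex_def
    proof (intro ballI allI impI)
      fix z z' :: "real vec" and a b :: real
      assume "z \<in> S" "z' \<in> S" and ab: "0 \<le> a" "0 \<le> b" "a + b = 1"
      then obtain x x' where x: "z = w2 - D2 *\<^sub>v x" "x \<in> carrier_vec n" "D1 *\<^sub>v x \<le> w1"
        and x': "z' = w2 - D2 *\<^sub>v x'" "x' \<in> carrier_vec n" "D1 *\<^sub>v x' \<le> w1"
        by (auto simp: S_def)
      have lin: "E *\<^sub>v (a \<cdot>\<^sub>v x + b \<cdot>\<^sub>v x') = a \<cdot>\<^sub>v (E *\<^sub>v x) + b \<cdot>\<^sub>v (E *\<^sub>v x')"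
        if "E \<in> carrier_mat k n" for E :: "real mat" and k
        using that x(2) x'(2) by (simp add: mult_add_distrib_mat_vec[of _ k n] mult_mat_vec[of _ k n])
      have b: "b = 1 - a" using ab by simp
      have "a \<cdot>\<^sub>v z + b \<cdot>\<^sub>v z' = w2 - D2 *\<^sub>v (a \<cdot>\<^sub>v x + b \<cdot>\<^sub>v x')"
        unfolding lin[OF D2] x(1) x'(1) using w2 D2 x(2) x'(2)
        by (intro eq_vecI) (auto simp: b algebra_simps)
      moreover have "D1 *\<^sub>v (a \<cdot>\<^sub>v x + b \<cdot>\<^sub>v x') \<le> w1"
        unfolding lin[OF D1] using x(3) x'(3) D1 w1 ab
        by (auto simp: less_eq_vec_def intro!: convex_bound_le)
      ultimately show "a \<cdot>\<^sub>v z + b \<cdot>\<^sub>v z' \<in> S" unfolding S_def using x(2) x'(2) by auto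
    qed
  qed
  then obtain a where a: "a \<in> carrier_vec l" "a \<noteq> 0\<^sub>v l"
    and sep: "\<And>x y. x \<in> L \<Longrightarrow> y \<in> S \<Longrightarrow> a \<bullet> y \<le> a \<bullet> x" by blast
  have a_S: "a \<bullet> y \<le> 0" if "y \<in> S" for y using sep[OF L0 that] a(1) by simp
  have "0 \<le> a \<bullet> x" if x: "x \<in> L" for x
  proof (rule ccontr)
    assume neg: "\<not> 0 \<le> a \<bullet> x"
    define \<beta> where "\<beta> = a \<bullet> (w2 - D2 *\<^sub>v x0)"
    have \<beta>: "\<beta> \<le> a \<bullet> y" if "y \<in> L" for y
      unfolding \<beta>_def using x0 by (intro sep that) (auto simp: S_def)
    \<comment> \<open>Scaling \<open>x\<close> by this factor brings its pairing with
      \<open>a\<close> down to \<open>- (\<bar>\<beta>\<bar> + 1)\<close>, below the lower bound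
      \<beta> valid on all of \<open>L\<close>.\<close>
    let ?t = "(\<bar>\<beta>\<bar> + 1) / - (a \<bullet> x)"
    have t: "0 < ?t" using neg by (intro divide_pos_pos) auto
    have "\<beta> \<le> a \<bullet> (?t \<cdot>\<^sub>v x)"
      by (rule \<beta>[OF L_scale[OF x less_imp_le[OF t]]])
    also have "\<dots> = ?t * (a \<bullet> x)" using a(1) x Lc by (intro scalar_prod_smult_distrib) auto
    also have "\<dots> = - (\<bar>\<beta>\<bar> + 1)" using neg by (simp add: field_simps)
    finally show False by linarith
  qed
  then have a_dual: "a \<in> dual_cone l L" using a by (simp add: dual_cone_def)
  \<comment> \<open>The margin that the certificate guarantees per unit of the multiplier
    \<open>a\<close>; it is positive because \<open>q\<close> is interior.\<close>
  define c where "c = \<delta> * (a \<bullet> q)"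
  have c: "0 < c" using \<delta> dual_cone_interior_pos[OF a_dual a(2) q] by (simp add: c_def)
  define g where "g = transpose_mat D2 *\<^sub>v a"
  have g: "g \<in> carrier_vec n" using D2 by (intro carrier_vecI) (simp add: g_def)
  \<comment> \<open>The extra row demands \<open>a \<bullet> (w2 - D2 *\<^sub>v x) \<ge> c\<close>,
    against the bound 0 that separation imposes on \<open>S\<close>. Multipliers of the enlarged
    system are pairs \<open>(y1, \<mu> \<cdot>\<^sub>v a)\<close>, so the certificate makes it
    solvable.\<close>
  let ?E = "D1 @\<^sub>r mat_of_row g" and ?w = "w1 @\<^sub>v vec_of_list [a \<bullet> w2 - c]"
  have row: "mat_of_row g \<in> carrier_mat 1 n" using g by auto
  have "\<exists>x\<in>carrier_vec n. ?E *\<^sub>v x \<le> ?w"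
  proof (rule farkas)
    show "?E \<in> carrier_mat (m + 1) n" using D1 row by (rule carrier_append_rows)
    show "?w \<in> carrier_vec (m + 1)" using w1 by (intro append_carrier_vec) auto
    fix y :: "real vec"
    assume y: "y \<in> carrier_vec (m + 1)" "0\<^sub>v (m + 1) \<le> y" "transpose_mat ?E *\<^sub>v y = 0\<^sub>v n"
    obtain y1 y2 where yy: "y = y1 @\<^sub>v y2" "y1 \<in> carrier_vec m" "y2 \<in> carrier_vec 1"
      using y(1) by (rule carrier_vec_addE)
    define \<mu> where "\<mu> = y2 $ 0"
    have "0\<^sub>v (m + 1) = 0\<^sub>v m @\<^sub>v (0\<^sub>v 1 :: real vec)" by (intro eq_vecI) auto
    then have "0\<^sub>v m \<le> y1 \<and> 0\<^sub>v 1 \<le> y2"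
      using y(2) append_vec_le[of "0\<^sub>v m" m y1] yy by simp
    then have y1: "0\<^sub>v m \<le> y1" and \<mu>: "0 \<le> \<mu>"
      using yy(3) by (auto simp: less_eq_vec_def \<mu>_def)
    have gm: "\<mu> \<cdot>\<^sub>v g = transpose_mat D2 *\<^sub>v (\<mu> \<cdot>\<^sub>v a)"
      unfolding g_def using D2 a(1) by (simp add: mult_mat_vec[of _ n l])
    have "transpose_mat D1 *\<^sub>v y1 + transpose_mat D2 *\<^sub>v (\<mu> \<cdot>\<^sub>v a) = 0\<^sub>v n"
      using y(3) unfolding yy(1) transpose_append_rows_mult[OF D1 row yy(2,3)]
        transpose_row_mult[OF g yy(3)] \<mu>_def[symmetric] gm .
    moreover have "\<mu> \<cdot>\<^sub>v a \<in> dual_cone l L"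
      using a_dual \<mu> Lc by (auto simp: dual_cone_def subset_iff)
    ultimately have "\<delta> * (y1 \<bullet> v + (\<mu> \<cdot>\<^sub>v a) \<bullet> q) \<le> y1 \<bullet> w1 + (\<mu> \<cdot>\<^sub>v a) \<bullet> w2"
      using yy(2) y1 by (intro cert) auto
    moreover have "0 \<le> \<delta> * (y1 \<bullet> v)" using \<delta> scalar_prod_nonneg[OF y1 v(2)] by simp
    ultimately have "\<mu> * c \<le> y1 \<bullet> w1 + \<mu> * (a \<bullet> w2)"
      using a(1) qc w2 by (simp add: c_def algebra_simps)
    moreover have "y \<bullet> ?w = y1 \<bullet> w1 + y2 \<bullet> vec_of_list [a \<bullet> w2 - c]"
      unfolding yy(1) using yy w1 by (intro scalar_prod_append) auto
    moreover have "y2 \<bullet> vec_of_list [a \<bullet> w2 - c] = \<mu> * (a \<bullet> w2 - c)"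
      using yy(3) by (simp add: scalar_prod_def \<mu>_def)
    ultimately show "0 \<le> y \<bullet> ?w" by (simp add: algebra_simps)
  qed
  then obtain x where x: "x \<in> carrier_vec n" "D1 *\<^sub>v x \<le> w1"
      "mat_of_row g *\<^sub>v x \<le> vec_of_list [a \<bullet> w2 - c]"
    using append_rows_le[OF D1 row w1] by blast
  have "g \<bullet> x \<le> a \<bullet> w2 - c" using x(3) by (auto simp: less_eq_vec_def)
  moreover have "g \<bullet> x = a \<bullet> (D2 *\<^sub>v x)"
    unfolding g_def by (rule transpose_vec_mult_scalar[OF D2 x(1) a(1)])
  moreover have "a \<bullet> (w2 - D2 *\<^sub>v x) = a \<bullet> w2 - a \<bullet> (D2 *\<^sub>v x)"
    using a(1) w2 D2 x(1) by (intro scalar_prod_minus_distrib[of _ l]) auto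
  moreover have "a \<bullet> (w2 - D2 *\<^sub>v x) \<le> 0" using x by (intro a_S) (auto simp: S_def)
  ultimately show False using c by simp
qed

lemma append_rows_split:
  fixes D :: "real mat"
  assumes "D \<in> carrier_mat (m + l) n"
  obtains D1 D2 where "D1 \<in> carrier_mat m n" "D2 \<in> carrier_mat l n" "D = D1 @\<^sub>r D2"
proof
  let ?D1 = "mat m n (\<lambda>(i, j). D $$ (i, j))" and ?D2 = "mat l n (\<lambda>(i, j). D $$ (m + i, j))"
  show "D = ?D1 @\<^sub>r ?D2"
    using assms by (intro eq_matI) (auto simp: append_rows_def)
qed auto

lemma append_cols_mult:
  assumes "A \<in> carrier_mat k m" "B \<in> carrier_mat k n" "x \<in> carrier_vec m" "u \<in> carrier_vec n"
  shows "(A @\<^sub>c B) *\<^sub>v (x @\<^sub>v u) = A *\<^sub>v x + B *\<^sub>v u"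
proof -
  have "(A @\<^sub>c B) *\<^sub>v (x @\<^sub>v u)
      = (A *\<^sub>v x + B *\<^sub>v u) @\<^sub>v (0\<^sub>m 0 (dim_col A) *\<^sub>v x + 0\<^sub>m 0 (dim_col B) *\<^sub>v u)"
    unfolding append_cols_def using assms by (intro four_block_mat_mult_vec) auto
  also have "\<dots> = A *\<^sub>v x + B *\<^sub>v u" by (intro eq_vecI) auto
  finally show ?thesis .
qed

text \<open>Hides the product structure of \<open>K\<close>. What remains is a feasible point and a
  test for \<open>w\<close> to lie in \<open>K + im D\<close>: on every dual vector annihilating the
  image of \<open>D\<close>, \<open>w\<close> must retain a fixed positive fraction of the slack at
  that point.\<close>

lemma ess_strictly_feasible_solvable:
  fixes C D :: "real mat"
  assumes K: "regular_cone k K" and C: "C \<in> carrier_mat k nx" and D: "D \<in> carrier_mat k n"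
    and e: "e \<in> carrier_vec k" and ess: "ess_strictly_feasible K (C @\<^sub>c D) e"
  obtains x0 u0 where "x0 \<in> carrier_vec nx" "u0 \<in> carrier_vec n"
    "e - (C *\<^sub>v x0 + D *\<^sub>v u0) \<in> K"
    "\<And>w \<delta>. w \<in> carrier_vec k \<Longrightarrow> 0 < \<delta> \<Longrightarrow>
      (\<And>y. y \<in> dual_cone k K \<Longrightarrow> transpose_mat D *\<^sub>v y = 0\<^sub>v n \<Longrightarrow>
        \<delta> * (y \<bullet> (e - (C *\<^sub>v x0 + D *\<^sub>v u0))) \<le> y \<bullet> w) \<Longrightarrow>
      \<exists>u\<in>carrier_vec n. w - D *\<^sub>v u \<in> K"
proof -
  have CD: "C @\<^sub>c D \<in> carrier_mat k (nx + n)" using C D by (auto simp: append_cols_def)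
  obtain m l L P Q p q z where L: "regular_cone l L" and K_eq: "K = cone_prod (orthant m) L"
    and P: "P \<in> carrier_mat m (nx + n)" and Q: "Q \<in> carrier_mat l (nx + n)"
    and M: "C @\<^sub>c D = P @\<^sub>r Q" and p: "p \<in> carrier_vec m" and q: "q \<in> carrier_vec l"
    and e_eq: "e = p @\<^sub>v q" and z: "z \<in> carrier_vec (nx + n)" "P *\<^sub>v z \<le> p"
    and int: "q - Q *\<^sub>v z \<in> euclid l interior_of L"
    using ess CD unfolding ess_strictly_feasible_def by auto
  have k: "k = m + l" using carrier_vecD[OF e] carrier_vecD[OF p] carrier_vecD[OF q] e_eq by simp
  obtain x0 u0 where z_eq: "z = x0 @\<^sub>v u0" and x0: "x0 \<in> carrier_vec nx" and u0: "u0 \<in> carrier_vec n"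
    using z(1) by (rule carrier_vec_addE)
  define v where "v = p - P *\<^sub>v z"
  define r where "r = q - Q *\<^sub>v z"
  have v: "v \<in> carrier_vec m" "0\<^sub>v m \<le> v"
    using p P z by (auto simp: v_def less_eq_vec_def)
  have r: "r \<in> euclid l interior_of L" "r \<in> L" "r \<in> carrier_vec l"
    using int subsetD[OF interior_of_subset int] q Q z by (auto simp: r_def)
  have slack: "e - (C *\<^sub>v x0 + D *\<^sub>v u0) = v @\<^sub>v r"
  proof -
    have "C *\<^sub>v x0 + D *\<^sub>v u0 = (P *\<^sub>v z) @\<^sub>v (Q *\<^sub>v z)"
      using append_cols_mult[OF C D x0 u0] mat_mult_append[OF P Q z(1)] by (simp add: M z_eq)
    then show ?thesis
      unfolding e_eq v_def r_def using p q P Q z by (simp add: minus_append_vec[of _ m _ _ l])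
  qed
  obtain D1 D2 where D1: "D1 \<in> carrier_mat m n" and D2: "D2 \<in> carrier_mat l n"
    and D_eq: "D = D1 @\<^sub>r D2"
    using D unfolding k by (rule append_rows_split)
  show thesis
  proof (rule that[OF x0 u0])
    show "e - (C *\<^sub>v x0 + D *\<^sub>v u0) \<in> K"
      unfolding slack K_eq cone_prod_def orthant_def using v r by blast
    fix w :: "real vec" and \<delta> :: real
    assume w: "w \<in> carrier_vec k" and \<delta>: "0 < \<delta>"
      and cert: "\<And>y. y \<in> dual_cone k K \<Longrightarrow> transpose_mat D *\<^sub>v y = 0\<^sub>v n \<Longrightarrow>
        \<delta> * (y \<bullet> (e - (C *\<^sub>v x0 + D *\<^sub>v u0))) \<le> y \<bullet> w"
    obtain w1 w2 where w_eq: "w = w1 @\<^sub>v w2" and w1: "w1 \<in> carrier_vec m" and w2: "w2 \<in> carrier_vec l"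
      using w unfolding k by (rule carrier_vec_addE)
    have "\<exists>u\<in>carrier_vec n. D1 *\<^sub>v u \<le> w1 \<and> w2 - D2 *\<^sub>v u \<in> L"
    proof (rule slater_feasible[OF L D1 D2 w1 w2 v r(1) \<delta>])
      fix y1 y2 assume y1: "y1 \<in> carrier_vec m" "0\<^sub>v m \<le> y1" and y2: "y2 \<in> dual_cone l L"
        and eq: "transpose_mat D1 *\<^sub>v y1 + transpose_mat D2 *\<^sub>v y2 = 0\<^sub>v n"
      have y2c: "y2 \<in> carrier_vec l" using y2 by (simp add: dual_cone_def)
      have "y1 @\<^sub>v y2 \<in> dual_cone k K"
        unfolding dual_cone_def
      proof (intro CollectI conjI ballI)
        show "y1 @\<^sub>v y2 \<in> carrier_vec k" unfolding k using y1 y2c by simp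
        fix x assume "x \<in> K"
        then obtain a b where x: "x = a @\<^sub>v b" "a \<in> carrier_vec m" "0\<^sub>v m \<le> a" "b \<in> L"
          by (auto simp: K_eq cone_prod_def orthant_def)
        have "b \<in> carrier_vec l" using x(4) L by (auto simp: regular_cone_def)
        then have "(y1 @\<^sub>v y2) \<bullet> x = y1 \<bullet> a + y2 \<bullet> b"
          unfolding x(1) using y1 y2c x(2) by (intro scalar_prod_append)
        moreover have "0 \<le> y1 \<bullet> a" using y1(2) x(3) by (rule scalar_prod_nonneg)
        moreover have "0 \<le> y2 \<bullet> b" using y2 x(4) by (simp add: dual_cone_def)
        ultimately show "0 \<le> (y1 @\<^sub>v y2) \<bullet> x" by simp
      qed
      moreover have "transpose_mat D *\<^sub>v (y1 @\<^sub>v y2) = 0\<^sub>v n"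
        unfolding D_eq transpose_append_rows_mult[OF D1 D2 y1(1) y2c] by (rule eq)
      ultimately have "\<delta> * ((y1 @\<^sub>v y2) \<bullet> (v @\<^sub>v r)) \<le> (y1 @\<^sub>v y2) \<bullet> (w1 @\<^sub>v w2)"
        using cert unfolding slack w_eq by blast
      then show "\<delta> * (y1 \<bullet> v + y2 \<bullet> r) \<le> y1 \<bullet> w1 + y2 \<bullet> w2"
        using scalar_prod_append[OF y1(1) y2c v(1) r(3)] scalar_prod_append[OF y1(1) y2c w1 w2]
        by simp
    qed
    then obtain u where u: "u \<in> carrier_vec n" "D1 *\<^sub>v u \<le> w1" "w2 - D2 *\<^sub>v u \<in> L" by blast
    have "w - D *\<^sub>v u = (w1 - D1 *\<^sub>v u) @\<^sub>v (w2 - D2 *\<^sub>v u)"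
      unfolding w_eq D_eq mat_mult_append[OF D1 D2 u(1)]
      using w1 w2 D1 D2 u(1) by (intro minus_append_vec) auto
    moreover have "w1 - D1 *\<^sub>v u \<in> orthant m"
      using w1 D1 u by (auto simp: orthant_def less_eq_vec_def)
    ultimately have "w - D *\<^sub>v u \<in> K" unfolding K_eq cone_prod_def using u(3) by blast
    then show "\<exists>u\<in>carrier_vec n. w - D *\<^sub>v u \<in> K" using u(1) by blast
  qed
qed

text \<open>Such a multiplier is orthogonal to the image of \<open>D\<close>, so its pairing with
  the slack does not depend on the auxiliary variable.\<close>

lemma multiplier_slack:
  fixes C D :: "real mat"
  assumes C: "C \<in> carrier_mat k n" and D: "D \<in> carrier_mat k nu" and e: "e \<in> carrier_vec k"
    and x: "x \<in> carrier_vec n" and u: "u \<in> carrier_vec nu" and \<mu>: "\<mu> \<in> carrier_vec k"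
    and zero: "transpose_mat D *\<^sub>v \<mu> = 0\<^sub>v nu"
  shows "\<mu> \<bullet> (e - (C *\<^sub>v x + D *\<^sub>v u)) = e \<bullet> \<mu> - \<mu> \<bullet> (C *\<^sub>v x)"
proof -
  have "\<mu> \<bullet> (D *\<^sub>v u) = 0"
    using transpose_vec_mult_scalar[OF D u \<mu>] u by (simp add: zero)
  then show ?thesis
    using \<mu> e C D x u comm_scalar_prod[OF e \<mu>]
    by (simp add: scalar_prod_minus_distrib[of _ k] scalar_prod_add_distrib[of _ k])
qed

text \<open>The conditions \<open>\<phi>_le\<close> and \<open>\<phi>_ge\<close> make \<phi> the
  pointwise infimum over \<open>G\<close> of the affine functions \<open>f \<bullet> y + t\<close>
  on \<open>Y\<close>, in a form free of \<open>Inf\<close>. The strict inequality in the conclusion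
  is what a common point of the two sets delivers.\<close>

lemma conic_minimax_multiplier:
  fixes G :: "(real vec \<times> real) set"
  assumes K: "regular_cone k K" and C: "C \<in> carrier_mat k n" and D: "D \<in> carrier_mat k nu"
    and e: "e \<in> carrier_vec k" and ess: "ess_strictly_feasible K (C @\<^sub>c D) e"
    and Y: "Y = represented_set K C D e" "compactin (euclid n) Y"
    and G: "fst ` G \<subseteq> carrier_vec n" "G \<noteq> {}"
    and G_convex: "\<And>f t f' t' a b. (f, t) \<in> G \<Longrightarrow> (f', t') \<in> G \<Longrightarrow> 0 \<le> a \<Longrightarrow> 0 \<le> b \<Longrightarrow> a + b = 1 \<Longrightarrow>
      (a \<cdot>\<^sub>v f + b \<cdot>\<^sub>v f', a * t + b * t') \<in> G"
    and \<phi>_le: "\<And>y f t. y \<in> Y \<Longrightarrow> (f, t) \<in> G \<Longrightarrow> \<phi> y \<le> f \<bullet> y + t"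
    and \<phi>_ge: "\<And>y r. y \<in> Y \<Longrightarrow> (\<And>f t. (f, t) \<in> G \<Longrightarrow> r \<le> f \<bullet> y + t) \<Longrightarrow> r \<le> \<phi> y"
    and bound: "\<And>y. y \<in> Y \<Longrightarrow> \<phi> y \<le> M" and M: "M < v"
  shows "\<exists>f t \<mu>. (f, t) \<in> G \<and> \<mu> \<in> dual_cone k K \<and> transpose_mat C *\<^sub>v \<mu> = f \<and>
    transpose_mat D *\<^sub>v \<mu> = 0\<^sub>v nu \<and> e \<bullet> \<mu> + t < v"
proof (rule ccontr)
  assume no: "\<not> ?thesis"
  have K_carrier: "K \<subseteq> carrier_vec k" using K by (simp add: regular_cone_def)
  \<comment> \<open>The convex cone of multipliers \<mu> for which
    \<open>\<mu> \<bullet> (C *\<^sub>v y) \<le> e \<bullet> \<mu>\<close> holds on \<open>Y\<close>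
    with the auxiliary variables eliminated.\<close>
  define W where "W = {\<mu> \<in> dual_cone k K. transpose_mat D *\<^sub>v \<mu> = 0\<^sub>v nu}"
  have Wc: "\<mu> \<in> carrier_vec k" if "\<mu> \<in> W" for \<mu> using that by (simp add: W_def dual_cone_def)
  have W_0: "0\<^sub>v k \<in> W"
  proof -
    have "transpose_mat D *\<^sub>v 0\<^sub>v k = 0\<^sub>v nu" using D by auto
    then show ?thesis using K_carrier by (auto simp: W_def dual_cone_def)
  qed
  have W_add: "a \<cdot>\<^sub>v \<mu> + b \<cdot>\<^sub>v \<nu> \<in> W" if "\<mu> \<in> W" "\<nu> \<in> W" "0 \<le> a" "0 \<le> b" for \<mu> \<nu> and a b :: real
  proof -
    have "transpose_mat D *\<^sub>v (a \<cdot>\<^sub>v \<mu> + b \<cdot>\<^sub>v \<nu>) = 0\<^sub>v nu"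
      using that Wc[of \<mu>] Wc[of \<nu>] D
      by (auto simp: W_def mult_add_distrib_mat_vec[of _ nu k] mult_mat_vec[of _ nu k])
    moreover have "0 \<le> (a \<cdot>\<^sub>v \<mu> + b \<cdot>\<^sub>v \<nu>) \<bullet> x" if x: "x \<in> K" for x
    proof -
      have "(a \<cdot>\<^sub>v \<mu> + b \<cdot>\<^sub>v \<nu>) \<bullet> x = a * (\<mu> \<bullet> x) + b * (\<nu> \<bullet> x)"
        using Wc[of \<mu>] Wc[of \<nu>] \<open>\<mu> \<in> W\<close> \<open>\<nu> \<in> W\<close> x K_carrier
        by (subst add_scalar_prod_distrib[of _ k]) auto
      moreover have "0 \<le> \<mu> \<bullet> x" "0 \<le> \<nu> \<bullet> x"
        using \<open>\<mu> \<in> W\<close> \<open>\<nu> \<in> W\<close> x by (auto simp: W_def dual_cone_def)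
      ultimately show ?thesis using \<open>0 \<le> a\<close> \<open>0 \<le> b\<close> by simp
    qed
    ultimately show ?thesis using that Wc[of \<mu>] Wc[of \<nu>] by (auto simp: W_def dual_cone_def)
  qed
  \<comment> \<open>These are the two sets of the overview, with \<open>t\<close> as leading
    coordinate: \<open>S\<close> corresponds to its \<open>G\<close>, and \<open>T\<close> to its
    \<open>H\<close>.\<close>
  define S where "S = {vCons t f | f t. (f, t) \<in> G}"
  define T where "T = {vCons t (transpose_mat C *\<^sub>v \<mu>) | t \<mu>. \<mu> \<in> W \<and> e \<bullet> \<mu> + t < v}"
  have "\<exists>c\<in>carrier_vec (Suc n). c \<noteq> 0\<^sub>v (Suc n) \<and> (\<forall>x\<in>S. \<forall>y\<in>T. c \<bullet> y \<le> c \<bullet> x)"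
  proof (rule separate_disjoint_convex)
    show "S \<subseteq> carrier_vec (Suc n)" using G(1) by (force simp: S_def)
    show "T \<subseteq> carrier_vec (Suc n)" using C Wc by (auto simp: T_def)
    show "S \<noteq> {}" using G(2) by (auto simp: S_def)
    show "T \<noteq> {}"
      unfolding T_def using W_0 e
      by (auto intro!: exI[of _ "v - 1"] exI[of _ "0\<^sub>v k"])
    show "S \<inter> T = {}"
    proof (rule ccontr)
      assume "S \<inter> T \<noteq> {}"
      then obtain t \<mu> where "(transpose_mat C *\<^sub>v \<mu>, t) \<in> G" "\<mu> \<in> W" "e \<bullet> \<mu> + t < v"
        by (auto simp: S_def T_def)
      then show False using no unfolding W_def by blast
    qed
    show "vec_convex S" unfolding vec_convex_def
    proof (intro ballI allI impI)
      fix x y and a b :: real assume "x \<in> S" "y \<in> S" and ab: "0 \<le> a" "0 \<le> b" "a + b = 1"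
      then obtain f t f' t' where xy: "x = vCons t f" "(f, t) \<in> G" "y = vCons t' f'" "(f', t') \<in> G"
        by (auto simp: S_def)
      then have "dim_vec f = n" "dim_vec f' = n" using G(1) by force+
      then have "a \<cdot>\<^sub>v x + b \<cdot>\<^sub>v y = vCons (a * t + b * t') (a \<cdot>\<^sub>v f + b \<cdot>\<^sub>v f')"
        unfolding xy by (simp add: vCons_smult vCons_add)
      then show "a \<cdot>\<^sub>v x + b \<cdot>\<^sub>v y \<in> S" unfolding S_def using G_convex[OF xy(2,4) ab] by blast
    qed
    show "vec_convex T" unfolding vec_convex_def
    proof (intro ballI allI impI)
      fix x y and a b :: real assume "x \<in> T" "y \<in> T" and ab: "0 \<le> a" "0 \<le> b" "a + b = 1"
      then obtain t \<mu> t' \<nu> where x: "x = vCons t (transpose_mat C *\<^sub>v \<mu>)" "\<mu> \<in> W" "e \<bullet> \<mu> + t < v"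
        and y: "y = vCons t' (transpose_mat C *\<^sub>v \<nu>)" "\<nu> \<in> W" "e \<bullet> \<nu> + t' < v"
        by (auto simp: T_def)
      have "a \<cdot>\<^sub>v x + b \<cdot>\<^sub>v y = vCons (a * t + b * t') (transpose_mat C *\<^sub>v (a \<cdot>\<^sub>v \<mu> + b \<cdot>\<^sub>v \<nu>))"
        unfolding x y using Wc[OF x(2)] Wc[OF y(2)] C
        by (simp add: vCons_smult vCons_add mult_add_distrib_mat_vec[of _ n k] mult_mat_vec[of _ n k])
      moreover have "e \<bullet> (a \<cdot>\<^sub>v \<mu> + b \<cdot>\<^sub>v \<nu>) + (a * t + b * t') = a * (e \<bullet> \<mu> + t) + b * (e \<bullet> \<nu> + t')"
        using Wc[OF x(2)] Wc[OF y(2)] e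
        by (simp add: scalar_prod_add_distrib[of _ k] algebra_simps)
      moreover have "a * (e \<bullet> \<mu> + t) + b * (e \<bullet> \<nu> + t') < v"
        using x(3) y(3) ab by (intro convex_bound_lt)
      ultimately show "a \<cdot>\<^sub>v x + b \<cdot>\<^sub>v y \<in> T"
        unfolding T_def using W_add[OF x(2) y(2) ab(1,2)] by auto
    qed
  qed
  then obtain c where c: "c \<in> carrier_vec (Suc n)" "c \<noteq> 0\<^sub>v (Suc n)"
    and sep: "\<And>x y. x \<in> S \<Longrightarrow> y \<in> T \<Longrightarrow> c \<bullet> y \<le> c \<bullet> x" by blast
  obtain b a where c_eq: "c = vCons b a" and a: "a \<in> carrier_vec n" using c(1) by (rule carrier_vec_SucE)
  have sep': "b * t' + \<mu> \<bullet> (C *\<^sub>v a) \<le> b * t + a \<bullet> f"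
    if "(f, t) \<in> G" "\<mu> \<in> W" "e \<bullet> \<mu> + t' < v" for f t \<mu> t'
  proof -
    have "c \<bullet> vCons t' (transpose_mat C *\<^sub>v \<mu>) \<le> c \<bullet> vCons t f"
      using that by (intro sep) (auto simp: S_def T_def)
    moreover have "transpose_mat C *\<^sub>v \<mu> \<in> carrier_vec n"
      using C by (intro carrier_vecI) simp
    then have "a \<bullet> (transpose_mat C *\<^sub>v \<mu>) = \<mu> \<bullet> (C *\<^sub>v a)"
      using transpose_vec_mult_scalar[OF C a Wc[OF that(2)]] a by (simp add: comm_scalar_prod[of a n])
    ultimately show ?thesis by (simp add: c_eq)
  qed
  obtain f0 t0 where ft: "(f0, t0) \<in> G" using G(2) by auto
  have b_nonneg: "0 \<le> b"
  proof (rule ccontr)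
    assume b: "\<not> 0 \<le> b"
    define h where "h = b * t0 + a \<bullet> f0"
    \<comment> \<open>For negative \<open>b\<close> this choice stays below \<open>v\<close> and
      makes \<open>b * t'\<close> at least \<open>h + 1\<close>.\<close>
    define t' where "t' = min (v - 1) ((h + 1) / b)"
    have "t' < v" by (simp add: t'_def)
    then have "b * t' + 0\<^sub>v k \<bullet> (C *\<^sub>v a) \<le> h"
      unfolding h_def using e by (intro sep' ft W_0) auto
    then have "b * t' \<le> h" using C a by simp
    moreover have "b * ((h + 1) / b) \<le> b * t'" using b by (intro mult_left_mono_neg) (auto simp: t'_def)
    ultimately show False using b by simp
  qed
  \<comment> \<open>Homogenisation: replace \<mu> by \<open>s \<cdot>\<^sub>v \<mu>\<close> and
    lower the scalar to \<open>v - 1 - s * (e \<bullet> \<mu>)\<close>, which remains in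
    \<open>T\<close>. A violation of size \<open>d\<close> would grow like \<open>s * d\<close>,
    while the bound \<open>h\<close> stays fixed.\<close>
  have W_sep: "\<mu> \<bullet> (C *\<^sub>v a) \<le> b * (e \<bullet> \<mu>)" if \<mu>: "\<mu> \<in> W" for \<mu>
  proof (rule ccontr)
    assume neg: "\<not> ?thesis"
    define d where "d = \<mu> \<bullet> (C *\<^sub>v a) - b * (e \<bullet> \<mu>)"
    define h where "h = b * t0 + a \<bullet> f0 - b * (v - 1)"
    define s where "s = (\<bar>h\<bar> + 1) / d"
    have d: "0 < d" using neg by (simp add: d_def)
    have s: "0 \<le> s" using d by (simp add: s_def)
    have "s \<cdot>\<^sub>v \<mu> + 0 \<cdot>\<^sub>v 0\<^sub>v k = s \<cdot>\<^sub>v \<mu>" using Wc[OF \<mu>] by (intro eq_vecI) auto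
    then have sW: "s \<cdot>\<^sub>v \<mu> \<in> W"
      using W_add[OF \<mu> W_0 s order_refl] by simp
    have "e \<bullet> (s \<cdot>\<^sub>v \<mu>) = s * (e \<bullet> \<mu>)" using e Wc[OF \<mu>] by simp
    then have "b * (v - 1 - s * (e \<bullet> \<mu>)) + (s \<cdot>\<^sub>v \<mu>) \<bullet> (C *\<^sub>v a) \<le> b * t0 + a \<bullet> f0"
      by (intro sep' ft sW) simp
    moreover have "(s \<cdot>\<^sub>v \<mu>) \<bullet> (C *\<^sub>v a) = s * (\<mu> \<bullet> (C *\<^sub>v a))" using Wc[OF \<mu>] C a by simp
    ultimately have "s * d \<le> h" by (simp add: d_def h_def algebra_simps)
    moreover have "s * d = \<bar>h\<bar> + 1" using d by (simp add: s_def)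
    ultimately show False by linarith
  qed
  obtain x0 u0 where x0: "x0 \<in> carrier_vec n" and u0: "u0 \<in> carrier_vec nu"
    and x0K: "e - (C *\<^sub>v x0 + D *\<^sub>v u0) \<in> K"
    and solvable: "\<And>w \<delta>. w \<in> carrier_vec k \<Longrightarrow> 0 < \<delta> \<Longrightarrow>
      (\<And>y. y \<in> dual_cone k K \<Longrightarrow> transpose_mat D *\<^sub>v y = 0\<^sub>v nu \<Longrightarrow>
        \<delta> * (y \<bullet> (e - (C *\<^sub>v x0 + D *\<^sub>v u0))) \<le> y \<bullet> w) \<Longrightarrow>
      \<exists>u\<in>carrier_vec nu. w - D *\<^sub>v u \<in> K"
    using ess_strictly_feasible_solvable[OF K C D e ess] by metis
  have in_Y: "y \<in> Y \<longleftrightarrow> y \<in> carrier_vec n \<and> (\<exists>u\<in>carrier_vec nu. e - (C *\<^sub>v y + D *\<^sub>v u) \<in> K)" for y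
    using C D by (simp add: Y(1) represented_set_def cone_le_def)
  have x0Y: "x0 \<in> Y" using x0 u0 x0K by (auto simp: in_Y)
  have slack: "\<mu> \<bullet> (e - (C *\<^sub>v x0 + D *\<^sub>v u0)) = e \<bullet> \<mu> - \<mu> \<bullet> (C *\<^sub>v x0)" if "\<mu> \<in> W" for \<mu>
    using that by (intro multiplier_slack[OF C D e x0 u0 Wc]) (auto simp: W_def)
  \<comment> \<open>Membership in \<open>Y\<close> tested by multipliers alone, with a fraction
    \<delta> of the slack at \<open>x0\<close> as margin.\<close>
  have Y_crit: "y \<in> Y" if y: "y \<in> carrier_vec n" and \<delta>: "0 < \<delta>"
    and le: "\<And>\<mu>. \<mu> \<in> W \<Longrightarrow> \<delta> * (e \<bullet> \<mu> - \<mu> \<bullet> (C *\<^sub>v x0)) \<le> e \<bullet> \<mu> - \<mu> \<bullet> (C *\<^sub>v y)" for y \<delta>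
  proof -
    have "\<exists>u\<in>carrier_vec nu. (e - C *\<^sub>v y) - D *\<^sub>v u \<in> K"
    proof (rule solvable[OF _ \<delta>])
      show "e - C *\<^sub>v y \<in> carrier_vec k" using e C y by simp
      fix \<mu> assume "\<mu> \<in> dual_cone k K" "transpose_mat D *\<^sub>v \<mu> = 0\<^sub>v nu"
      then have \<mu>: "\<mu> \<in> W" by (simp add: W_def)
      have "\<mu> \<bullet> (e - C *\<^sub>v y) = e \<bullet> \<mu> - \<mu> \<bullet> (C *\<^sub>v y)"
        using Wc[OF \<mu>] e C y comm_scalar_prod[OF e Wc[OF \<mu>]]
        by (simp add: scalar_prod_minus_distrib[of _ k])
      then show "\<delta> * (\<mu> \<bullet> (e - (C *\<^sub>v x0 + D *\<^sub>v u0))) \<le> \<mu> \<bullet> (e - C *\<^sub>v y)"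
        using le[OF \<mu>] slack[OF \<mu>] by simp
    qed
    then obtain u where u: "u \<in> carrier_vec nu" "(e - C *\<^sub>v y) - D *\<^sub>v u \<in> K" by blast
    have "(e - C *\<^sub>v y) - D *\<^sub>v u = e - (C *\<^sub>v y + D *\<^sub>v u)"
      using e C D y u(1) by (intro eq_vecI) auto
    then show ?thesis using u y by (auto simp: in_Y)
  qed
  have C_lin: "\<mu> \<bullet> (C *\<^sub>v (r \<cdot>\<^sub>v y + s \<cdot>\<^sub>v y')) = r * (\<mu> \<bullet> (C *\<^sub>v y)) + s * (\<mu> \<bullet> (C *\<^sub>v y'))"
    if "\<mu> \<in> W" "y \<in> carrier_vec n" "y' \<in> carrier_vec n" for \<mu> y y' and r s :: real
    using Wc[OF that(1)] that(2,3) C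
    by (simp add: mult_add_distrib_mat_vec[of _ k n] mult_mat_vec[of _ k n] scalar_prod_add_distrib[of _ k])
  have slack_nonneg: "0 \<le> e \<bullet> \<mu> - \<mu> \<bullet> (C *\<^sub>v x0)" if "\<mu> \<in> W" for \<mu>
  proof -
    have "0 \<le> \<mu> \<bullet> (e - (C *\<^sub>v x0 + D *\<^sub>v u0))"
      using that x0K unfolding W_def dual_cone_def by blast
    then show ?thesis using slack[OF that] by simp
  qed
  show False
  proof (cases "b = 0")
    case True
    have "a = 0\<^sub>v n"
    proof (rule compactin_euclid_recession[OF Y(2) x0 a])
      fix s :: real assume s: "0 < s"
      \<comment> \<open>With \<open>b = 0\<close>, \<open>W_sep\<close> makes
        \<open>\<mu> \<bullet> (C *\<^sub>v a)\<close> nonpositive, so no multiplier sees less slack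
        along the ray than at \<open>x0\<close>, and \<delta> = 1 serves.\<close>
      show "x0 + s \<cdot>\<^sub>v a \<in> Y"
      proof (rule Y_crit[of _ 1])
        fix \<mu> assume \<mu>: "\<mu> \<in> W"
        have "\<mu> \<bullet> (C *\<^sub>v (x0 + s \<cdot>\<^sub>v a)) = \<mu> \<bullet> (C *\<^sub>v x0) + s * (\<mu> \<bullet> (C *\<^sub>v a))"
          using C_lin[OF \<mu> x0 a, of 1 s] by simp
        moreover have "s * (\<mu> \<bullet> (C *\<^sub>v a)) \<le> 0"
          using W_sep[OF \<mu>] True s by (simp add: mult_le_0_iff)
        ultimately show "1 * (e \<bullet> \<mu> - \<mu> \<bullet> (C *\<^sub>v x0)) \<le> e \<bullet> \<mu> - \<mu> \<bullet> (C *\<^sub>v (x0 + s \<cdot>\<^sub>v a))"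
          by simp
      qed (use x0 a in simp_all)
    qed
    then show False using c(2) True by (simp add: c_eq zero_vec_Suc)
  next
    case False
    then have b: "0 < b" using b_nonneg by simp
    define ya where "ya = (1 / b) \<cdot>\<^sub>v a"
    have ya: "ya \<in> carrier_vec n" using a by (simp add: ya_def)
    \<comment> \<open>Separation is used with the zero multiplier and scalars approaching
      \<open>v\<close>. The bound concerns the affine functions and not \<phi>, since
      \<open>ya\<close> may lie outside \<open>Y\<close>.\<close>
    have G_ge: "v \<le> f \<bullet> ya + t" if ft: "(f, t) \<in> G" for f t
    proof (rule dense_le)
      fix t' assume "t' < v"
      then have "b * t' + 0\<^sub>v k \<bullet> (C *\<^sub>v a) \<le> b * t + a \<bullet> f"
        using e by (intro sep' ft W_0) auto
      moreover have f: "f \<in> carrier_vec n" using G(1) ft by force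
      ultimately show "t' \<le> f \<bullet> ya + t"
        using b a C comm_scalar_prod[OF f a] by (simp add: ya_def field_simps)
    qed
    \<comment> \<open>Moving this far towards \<open>x0\<close> costs
      \<open>\<delta> * (v - \<phi> x0) = (v - M) / 2\<close>, so the bound at \<open>y\<close> is
      the midpoint of \<open>M\<close> and \<open>v\<close>, still above \<open>M\<close>.\<close>
    define \<delta> where "\<delta> = (v - M) / (2 * (v - \<phi> x0))"
    have gap: "v - M \<le> v - \<phi> x0" "0 < v - M" using bound[OF x0Y] M by auto
    then have \<delta>: "0 < \<delta>" "\<delta> \<le> 1" by (auto simp: \<delta>_def field_simps)
    define y where "y = (1 - \<delta>) \<cdot>\<^sub>v ya + \<delta> \<cdot>\<^sub>v x0"
    have yY: "y \<in> Y"
    proof (rule Y_crit[OF _ \<delta>(1)])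
      show "y \<in> carrier_vec n" using ya x0 by (simp add: y_def)
      fix \<mu> assume \<mu>: "\<mu> \<in> W"
      have "b * (\<mu> \<bullet> (C *\<^sub>v ya)) = \<mu> \<bullet> (C *\<^sub>v a)"
        using Wc[OF \<mu>] C a b by (simp add: ya_def mult_mat_vec[of _ k n])
      then have "b * (\<mu> \<bullet> (C *\<^sub>v ya)) \<le> b * (e \<bullet> \<mu>)" using W_sep[OF \<mu>] by simp
      then have "\<mu> \<bullet> (C *\<^sub>v ya) \<le> e \<bullet> \<mu>" by (simp only: mult_le_cancel_left_pos[OF b])
      then have "0 \<le> (1 - \<delta>) * (e \<bullet> \<mu> - \<mu> \<bullet> (C *\<^sub>v ya))" using \<delta> by simp
      then show "\<delta> * (e \<bullet> \<mu> - \<mu> \<bullet> (C *\<^sub>v x0)) \<le> e \<bullet> \<mu> - \<mu> \<bullet> (C *\<^sub>v y)"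
        unfolding y_def C_lin[OF \<mu> ya x0] by (simp add: algebra_simps)
    qed
    have "(1 - \<delta>) * v + \<delta> * \<phi> x0 \<le> \<phi> y"
    proof (rule \<phi>_ge[OF yY])
      fix f t assume ft: "(f, t) \<in> G"
      then have f: "f \<in> carrier_vec n" using G(1) by force
      have "f \<bullet> y + t = (1 - \<delta>) * (f \<bullet> ya + t) + \<delta> * (f \<bullet> x0 + t)"
        unfolding y_def using f ya x0
        by (simp add: scalar_prod_add_distrib[of _ n] algebra_simps)
      moreover have "(1 - \<delta>) * v \<le> (1 - \<delta>) * (f \<bullet> ya + t)"
        using G_ge[OF ft] \<delta> by (intro mult_left_mono) auto
      moreover have "\<delta> * \<phi> x0 \<le> \<delta> * (f \<bullet> x0 + t)"
        using \<phi>_le[OF x0Y ft] \<delta> by (intro mult_left_mono) auto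
      ultimately show "(1 - \<delta>) * v + \<delta> * \<phi> x0 \<le> f \<bullet> y + t" by linarith
    qed
    then have "v - M \<le> \<delta> * (v - \<phi> x0)" using bound[OF yY] by (simp add: algebra_simps)
    also have "\<dots> = (v - M) / 2" using gap by (simp add: \<delta>_def field_simps)
    finally show False using gap by simp
  qed
qed

section \<open>Conic sets\<close>

text \<open>Agreement with a matrix is required on \<open>carrier_vec N\<close> only. Constraints
  can thus be assembled by composing and adding maps, without an explicit block matrix.\<close>

definition matrix_map :: "nat \<Rightarrow> nat \<Rightarrow> (real vec \<Rightarrow> real vec) \<Rightarrow> bool" where
  "matrix_map N k h \<longleftrightarrow> (\<exists>M\<in>carrier_mat k N. \<forall>z\<in>carrier_vec N. h z = M *\<^sub>v z)"

lemma matrix_map_mult: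
  assumes "matrix_map N m h" "E \<in> carrier_mat k m"
  shows "matrix_map N k (\<lambda>z. E *\<^sub>v h z)"
proof -
  obtain M where "M \<in> carrier_mat m N" "\<And>z. z \<in> carrier_vec N \<Longrightarrow> h z = M *\<^sub>v z"
    using assms(1) by (auto simp: matrix_map_def)
  then show ?thesis
    unfolding matrix_map_def using assms(2) by (intro bexI[of _ "E * M"]) auto
qed

lemma matrix_map_add:
  assumes "matrix_map N k h" "matrix_map N k h'"
  shows "matrix_map N k (\<lambda>z. h z + h' z)"
proof -
  obtain M M' where "M \<in> carrier_mat k N" "\<And>z. z \<in> carrier_vec N \<Longrightarrow> h z = M *\<^sub>v z"
    "M' \<in> carrier_mat k N" "\<And>z. z \<in> carrier_vec N \<Longrightarrow> h' z = M' *\<^sub>v z"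
    using assms by (auto simp: matrix_map_def)
  then show ?thesis
    unfolding matrix_map_def
    by (intro bexI[of _ "M + M'"]) (auto simp: add_mult_distrib_mat_vec[of _ k N])
qed

lemma matrix_map_uminus:
  assumes "matrix_map N k h"
  shows "matrix_map N k (\<lambda>z. - h z)"
proof -
  obtain M where "M \<in> carrier_mat k N" "\<And>z. z \<in> carrier_vec N \<Longrightarrow> h z = M *\<^sub>v z"
    using assms by (auto simp: matrix_map_def)
  then show ?thesis
    unfolding matrix_map_def by (intro bexI[of _ "- M"]) auto
qed

definition slice :: "nat \<Rightarrow> nat \<Rightarrow> real vec \<Rightarrow> real vec" where
  "slice i n z = Matrix.vec n (\<lambda>j. z $ (i + j))"

lemma slice_carrier [simp]: "slice i n z \<in> carrier_vec n"
  by (simp add: slice_def)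

lemma slice_all: "v \<in> carrier_vec n \<Longrightarrow> slice 0 n v = v"
  by (intro eq_vecI) (auto simp: slice_def)

lemma slice_concat: "slice i m z @\<^sub>v slice (i + m) n z = slice i (m + n) z"
  by (intro eq_vecI) (auto simp: slice_def)

lemma vec_of_list_singleton:
  assumes "v \<in> carrier_vec 1"
  shows "vec_of_list [v $ 0] = v"
  using assms by (intro eq_vecI) auto

lemma matrix_map_slice:
  assumes "i + n \<le> N"
  shows "matrix_map N n (slice i n)"
proof -
  let ?M = "mat n N (\<lambda>(r, c). if c = i + r then 1 else 0) :: real mat"
  have "slice i n z = ?M *\<^sub>v z" if "z \<in> carrier_vec N" for z
  proof (rule eq_vecI)
    fix r assume "r < dim_vec (?M *\<^sub>v z)"
    then have r: "r < n" by simp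
    then have "(?M *\<^sub>v z) $ r = (\<Sum>c\<in>{0..<N}. (if c = i + r then 1 else 0) * z $ c)"
      using that by (simp add: scalar_prod_def)
    also have "\<dots> = (\<Sum>c\<in>{0..<N}. if c = i + r then z $ c else 0)"
      by (intro sum.cong) auto
    also have "\<dots> = z $ (i + r)" using r assms by simp
    finally show "slice i n z $ r = (?M *\<^sub>v z) $ r" using r by (simp add: slice_def)
  qed (simp add: slice_def)
  then show ?thesis unfolding matrix_map_def by (intro bexI[of _ ?M]) auto
qed

text \<open>The feasible set of a conic problem in plain coordinates, isolated so that constraints
  can be added one at a time.\<close>

definition conic_set :: "(nat \<Rightarrow> real vec set set) \<Rightarrow> nat \<Rightarrow> real vec set \<Rightarrow> bool" where
  "conic_set \<K> N S \<longleftrightarrow> (\<exists>k K M a. K \<in> \<K> k \<and> M \<in> carrier_mat k N \<and> a \<in> carrier_vec k \<and>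
     S = {z \<in> carrier_vec N. M *\<^sub>v z \<preceq>\<^bsub>K\<^esub> a})"

lemma conic_set_cone_le:
  assumes "K \<in> \<K> k" "matrix_map N k h" "a \<in> carrier_vec k"
  shows "conic_set \<K> N {z \<in> carrier_vec N. h z \<preceq>\<^bsub>K\<^esub> a}"
proof -
  obtain M where M: "M \<in> carrier_mat k N" "\<And>z. z \<in> carrier_vec N \<Longrightarrow> h z = M *\<^sub>v z"
    using assms(2) by (auto simp: matrix_map_def)
  have "{z \<in> carrier_vec N. h z \<preceq>\<^bsub>K\<^esub> a} = {z \<in> carrier_vec N. M *\<^sub>v z \<preceq>\<^bsub>K\<^esub> a}"
    using M(2) by auto
  then show ?thesis unfolding conic_set_def using assms M(1) by blast
qed

text \<open>Two constraints are stacked into one over the product cone. The first block has the same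
  length on both sides, so membership in the product splits uniquely.\<close>

lemma conic_set_Int:
  assumes fam: "cone_family \<K>" and S: "conic_set \<K> N S" and T: "conic_set \<K> N T"
  shows "conic_set \<K> N (S \<inter> T)"
proof -
  obtain k K M a where K: "K \<in> \<K> k" and M: "M \<in> carrier_mat k N" and a: "a \<in> carrier_vec k"
    and S_eq: "S = {z \<in> carrier_vec N. M *\<^sub>v z \<preceq>\<^bsub>K\<^esub> a}" using S by (auto simp: conic_set_def)
  obtain l L M' b where L: "L \<in> \<K> l" and M': "M' \<in> carrier_mat l N" and b: "b \<in> carrier_vec l"
    and T_eq: "T = {z \<in> carrier_vec N. M' *\<^sub>v z \<preceq>\<^bsub>L\<^esub> b}" using T by (auto simp: conic_set_def)
  have Kc: "K \<subseteq> carrier_vec k" using fam K by (auto simp: cone_family_def regular_cone_def)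
  have iff: "(M @\<^sub>r M') *\<^sub>v z \<preceq>\<^bsub>cone_prod K L\<^esub> (a @\<^sub>v b) \<longleftrightarrow>
      M *\<^sub>v z \<preceq>\<^bsub>K\<^esub> a \<and> M' *\<^sub>v z \<preceq>\<^bsub>L\<^esub> b" if z: "z \<in> carrier_vec N" for z
  proof -
    have diff: "a - M *\<^sub>v z \<in> carrier_vec k" using a M z by simp
    have "(a @\<^sub>v b) - (M @\<^sub>r M') *\<^sub>v z = (a - M *\<^sub>v z) @\<^sub>v (b - M' *\<^sub>v z)"
      unfolding mat_mult_append[OF M M' z] using a b M M' z by (intro minus_append_vec) auto
    moreover have "(a - M *\<^sub>v z) @\<^sub>v (b - M' *\<^sub>v z) \<in> cone_prod K L \<longleftrightarrow>
        a - M *\<^sub>v z \<in> K \<and> b - M' *\<^sub>v z \<in> L"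
    proof
      assume "(a - M *\<^sub>v z) @\<^sub>v (b - M' *\<^sub>v z) \<in> cone_prod K L"
      then obtain v w where vw: "(a - M *\<^sub>v z) @\<^sub>v (b - M' *\<^sub>v z) = v @\<^sub>v w" "v \<in> K" "w \<in> L"
        by (auto simp: cone_prod_def)
      then show "a - M *\<^sub>v z \<in> K \<and> b - M' *\<^sub>v z \<in> L"
        using append_vec_eq[OF diff subsetD[OF Kc vw(2)]] by simp
    qed (auto simp: cone_prod_def)
    ultimately show ?thesis by (simp add: cone_le_def)
  qed
  have "S \<inter> T = {z \<in> carrier_vec N. (M @\<^sub>r M') *\<^sub>v z \<preceq>\<^bsub>cone_prod K L\<^esub> (a @\<^sub>v b)}"
    using iff by (auto simp: S_eq T_eq)
  moreover have "cone_prod K L \<in> \<K> (k + l)" using fam K L by (auto simp: cone_family_def)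
  ultimately show ?thesis unfolding conic_set_def
    by (intro exI[of _ "k + l"] exI[of _ "cone_prod K L"] exI[of _ "M @\<^sub>r M'"] exI[of _ "a @\<^sub>v b"]
        conjI carrier_append_rows[OF M M'] append_carrier_vec[OF a b])
qed

lemma conic_set_halfspace:
  assumes fam: "cone_family \<K>" and g: "g \<in> carrier_vec N"
  shows "conic_set \<K> N {z \<in> carrier_vec N. g \<bullet> z \<le> 0}"
proof -
  have "matrix_map N 1 (\<lambda>z. mat_of_row g *\<^sub>v z)"
    unfolding matrix_map_def using g by (intro bexI[of _ "mat_of_row g"]) auto
  moreover have "orthant 1 \<in> \<K> 1" using fam by (simp add: cone_family_def)
  ultimately have "conic_set \<K> N {z \<in> carrier_vec N. mat_of_row g *\<^sub>v z \<preceq>\<^bsub>orthant 1\<^esub> 0\<^sub>v 1}"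
    by (intro conic_set_cone_le) auto
  moreover have "mat_of_row g *\<^sub>v z \<preceq>\<^bsub>orthant 1\<^esub> 0\<^sub>v 1 \<longleftrightarrow> g \<bullet> z \<le> 0" for z
    by (auto simp: cone_le_def orthant_def less_eq_vec_def intro!: carrier_vecI)
  ultimately show ?thesis by simp
qed

text \<open>
  Intersecting halfspaces row by row avoids the orthant of dimension 0, which need not belong to
  the family.
\<close>

lemma conic_set_eq_zero:
  assumes fam: "cone_family \<K>" and h: "matrix_map N n h"
  shows "conic_set \<K> N {z \<in> carrier_vec N. h z = 0\<^sub>v n}"
proof -
  obtain M where M: "M \<in> carrier_mat n N" "\<And>z. z \<in> carrier_vec N \<Longrightarrow> h z = M *\<^sub>v z"
    using h by (auto simp: matrix_map_def)
  have "conic_set \<K> N {z \<in> carrier_vec N. \<forall>i<m. row M i \<bullet> z = 0}" if "m \<le> n" for m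
    using that
  proof (induction m)
    case 0
    \<comment> \<open>Without any row the set is the whole space, presented as the halfspace of the
      zero vector.\<close>
    have eq: "{z \<in> carrier_vec N. \<forall>i<0::nat. row M i \<bullet> z = 0} = {z \<in> carrier_vec N. 0\<^sub>v N \<bullet> z \<le> 0}"
      by auto
    show ?case unfolding eq by (rule conic_set_halfspace[OF fam zero_carrier_vec])
  next
    case (Suc m)
    let ?r = "row M m"
    have r: "?r \<in> carrier_vec N" using M(1) by auto
    have neg: "- ?r \<bullet> z = - (?r \<bullet> z)" if "z \<in> carrier_vec N" for z
      using carrier_vecD[OF r] carrier_vecD[OF that] by simp
    have eq: "{z \<in> carrier_vec N. \<forall>i<Suc m. row M i \<bullet> z = 0} = {z \<in> carrier_vec N. \<forall>i<m. row M i \<bullet> z = 0} \<inter>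
        ({z \<in> carrier_vec N. ?r \<bullet> z \<le> 0} \<inter> {z \<in> carrier_vec N. - ?r \<bullet> z \<le> 0})"
      using neg by (auto simp: less_Suc_eq)
    have "conic_set \<K> N {z \<in> carrier_vec N. \<forall>i<m. row M i \<bullet> z = 0}" using Suc by simp
    moreover have "- ?r \<in> carrier_vec N" using r by simp
    ultimately show ?case
      unfolding eq using r by (intro conic_set_Int[OF fam] conic_set_halfspace[OF fam])
  qed
  from this[OF order_refl] have "conic_set \<K> N {z \<in> carrier_vec N. \<forall>i<n. row M i \<bullet> z = 0}" .
  moreover have "h z = 0\<^sub>v n \<longleftrightarrow> (\<forall>i<n. row M i \<bullet> z = 0)" if z: "z \<in> carrier_vec N" for z
  proof
    assume "h z = 0\<^sub>v n"
    then have "(M *\<^sub>v z) $ i = 0" if "i < n" for i using M(2)[OF z] that by simp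
    then show "\<forall>i<n. row M i \<bullet> z = 0" using M(1) by simp
  next
    assume "\<forall>i<n. row M i \<bullet> z = 0"
    then show "h z = 0\<^sub>v n" unfolding M(2)[OF z] using M(1) by (intro eq_vecI) auto
  qed
  then have "{z \<in> carrier_vec N. h z = 0\<^sub>v n} = {z \<in> carrier_vec N. \<forall>i<n. row M i \<bullet> z = 0}"
    by auto
  ultimately show ?thesis by simp
qed

lemma conic_problemI:
  assumes bij: "bij_betw coord V (carrier_vec N)" and S: "conic_set \<K> N S"
    and F: "F = {\<zeta> \<in> V. coord \<zeta> \<in> S}"
    and g: "g \<in> carrier_vec N" and obj: "\<And>\<zeta>. \<zeta> \<in> V \<Longrightarrow> obj \<zeta> = g \<bullet> coord \<zeta>"
  shows "conic_problem \<K> N V coord F obj"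
proof -
  obtain k K M a where *: "K \<in> \<K> k" "M \<in> carrier_mat k N" "a \<in> carrier_vec k"
    and S_eq: "S = {z \<in> carrier_vec N. M *\<^sub>v z \<preceq>\<^bsub>K\<^esub> a}" using S by (auto simp: conic_set_def)
  have "F = {\<zeta> \<in> V. M *\<^sub>v coord \<zeta> \<preceq>\<^bsub>K\<^esub> a}"
    using bij_betwE[OF bij] by (auto simp: F S_eq)
  then show ?thesis unfolding conic_problem_def using bij * g obj by blast
qed

lemma slice_stack:
  assumes "x \<in> carrier_vec nx" "\<xi> \<in> carrier_vec n\<xi>" "f \<in> carrier_vec nf"
    and "u \<in> carrier_vec nu" "\<mu> \<in> carrier_vec n\<mu>"
  shows "slice 0 nx (stack (x, \<xi>, f, t, u, \<mu>)) = x"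
    and "slice nx n\<xi> (stack (x, \<xi>, f, t, u, \<mu>)) = \<xi>"
    and "slice (nx + n\<xi>) nf (stack (x, \<xi>, f, t, u, \<mu>)) = f"
    and "slice (nx + n\<xi> + nf) 1 (stack (x, \<xi>, f, t, u, \<mu>)) = vec_of_list [t]"
    and "slice (nx + n\<xi> + nf + 1) nu (stack (x, \<xi>, f, t, u, \<mu>)) = u"
    and "slice (nx + n\<xi> + nf + 1 + nu) n\<mu> (stack (x, \<xi>, f, t, u, \<mu>)) = \<mu>"
  using assms by (intro eq_vecI; auto simp: slice_def)+

lemma stack_carrier:
  assumes "x \<in> carrier_vec nx" "\<xi> \<in> carrier_vec n\<xi>" "f \<in> carrier_vec nf"
    and "u \<in> carrier_vec nu" "\<mu> \<in> carrier_vec n\<mu>"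
  shows "stack (x, \<xi>, f, t, u, \<mu>) \<in> carrier_vec (nx + n\<xi> + nf + 1 + nu + n\<mu>)"
  using assms by (intro carrier_vecI) auto

lemma stack_bij:
  "bij_betw stack (decisions nx n\<xi> nf nu n\<mu>) (carrier_vec (nx + n\<xi> + nf + 1 + nu + n\<mu>))"
proof (rule bij_betwI)
  let ?inv = "\<lambda>z. (slice 0 nx z, slice nx n\<xi> z, slice (nx + n\<xi>) nf z, slice (nx + n\<xi> + nf) 1 z $ 0,
    slice (nx + n\<xi> + nf + 1) nu z, slice (nx + n\<xi> + nf + 1 + nu) n\<mu> z)"
  show "stack \<in> decisions nx n\<xi> nf nu n\<mu> \<rightarrow> carrier_vec (nx + n\<xi> + nf + 1 + nu + n\<mu>)"
    using stack_carrier by (auto simp: decisions_def simp del: stack.simps)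
  show "?inv \<in> carrier_vec (nx + n\<xi> + nf + 1 + nu + n\<mu>) \<rightarrow> decisions nx n\<xi> nf nu n\<mu>"
    by (auto simp: decisions_def)
  show "?inv (stack \<zeta>) = \<zeta>" if "\<zeta> \<in> decisions nx n\<xi> nf nu n\<mu>" for \<zeta>
  proof -
    obtain x \<xi> f t u \<mu> where \<zeta>: "\<zeta> = (x, \<xi>, f, t, u, \<mu>)" by (metis prod_cases6)
    have c: "x \<in> carrier_vec nx" "\<xi> \<in> carrier_vec n\<xi>" "f \<in> carrier_vec nf"
        "u \<in> carrier_vec nu" "\<mu> \<in> carrier_vec n\<mu>"
      using that unfolding \<zeta> by (auto simp: decisions_def)
    show ?thesis by (simp only: \<zeta> slice_stack[OF c]) simp
  qed
  show "stack (?inv z) = z" if z: "z \<in> carrier_vec (nx + n\<xi> + nf + 1 + nu + n\<mu>)" for z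
  proof -
    have "vec_of_list [slice (nx + n\<xi> + nf) 1 z $ 0] = slice (nx + n\<xi> + nf) 1 z"
      by (rule vec_of_list_singleton) simp
    \<comment> \<open>The instance of \<open>slice_concat\<close> at offset 0, with
      \<open>0 + nx\<close> written as \<open>nx\<close> so that it matches the stacked
      vector.\<close>
    moreover have 0: "slice 0 nx z @\<^sub>v slice nx n z = slice 0 (nx + n) z" for n
      using slice_concat[of 0 nx z n] by simp
    have "slice 0 nx z @\<^sub>v slice nx n\<xi> z @\<^sub>v slice (nx + n\<xi>) nf z @\<^sub>v slice (nx + n\<xi> + nf) 1 z
        @\<^sub>v slice (nx + n\<xi> + nf + 1) nu z @\<^sub>v slice (nx + n\<xi> + nf + 1 + nu) n\<mu> z = z"
      unfolding slice_concat 0 using slice_all[OF z] by (simp only: add.assoc)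
    ultimately show ?thesis by (simp only: stack.simps)
  qed
qed

text \<open>The cost vector of (b) is itself a stacked decision, with 1 in the slot of
  \<open>t\<close> and \<open>e\<close> in the slot of \<mu>. Concatenation nests to the right, so
  blocks are added from the innermost outwards.\<close>

lemma scalar_prod_stack:
  assumes "x \<in> carrier_vec nx" "\<xi> \<in> carrier_vec n\<xi>" "f \<in> carrier_vec nf"
    and "u \<in> carrier_vec nu" "\<mu> \<in> carrier_vec n\<mu>" "e \<in> carrier_vec n\<mu>"
  shows "stack (0\<^sub>v nx, 0\<^sub>v n\<xi>, 0\<^sub>v nf, 1, 0\<^sub>v nu, e) \<bullet> stack (x, \<xi>, f, t, u, \<mu>) = e \<bullet> \<mu> + t"
proof -
  have t: "vec_of_list [r] \<in> carrier_vec 1" for r :: real by (rule carrier_vecI) simp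
  have 1: "(0\<^sub>v nu @\<^sub>v e) \<bullet> (u @\<^sub>v \<mu>) = e \<bullet> \<mu>"
    using assms by (subst scalar_prod_append[of _ nu _ n\<mu>]) (auto intro!: carrier_vecI)
  have "vec_of_list [1] \<bullet> vec_of_list [t] = (t :: real)" by (simp add: scalar_prod_def)
  then have 2: "(vec_of_list [1] @\<^sub>v 0\<^sub>v nu @\<^sub>v e) \<bullet> (vec_of_list [t] @\<^sub>v u @\<^sub>v \<mu>) = t + e \<bullet> \<mu>"
    using 1 assms t by (subst scalar_prod_append[of _ 1 _ "nu + n\<mu>"]) (auto intro!: carrier_vecI)
  have 3: "(0\<^sub>v nf @\<^sub>v vec_of_list [1] @\<^sub>v 0\<^sub>v nu @\<^sub>v e) \<bullet> (f @\<^sub>v vec_of_list [t] @\<^sub>v u @\<^sub>v \<mu>) = t + e \<bullet> \<mu>"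
    using 2 assms t by (subst scalar_prod_append[of _ nf _ "1 + (nu + n\<mu>)"]) (auto intro!: carrier_vecI)
  have 4: "(0\<^sub>v n\<xi> @\<^sub>v 0\<^sub>v nf @\<^sub>v vec_of_list [1] @\<^sub>v 0\<^sub>v nu @\<^sub>v e)
      \<bullet> (\<xi> @\<^sub>v f @\<^sub>v vec_of_list [t] @\<^sub>v u @\<^sub>v \<mu>) = t + e \<bullet> \<mu>"
    using 3 assms t by (subst scalar_prod_append[of _ n\<xi> _ "nf + (1 + (nu + n\<mu>))"]) (auto intro!: carrier_vecI)
  show ?thesis
    unfolding stack.simps using 4 assms t
    by (subst scalar_prod_append[of _ nx _ "n\<xi> + (nf + (1 + (nu + n\<mu>)))"]) (auto intro!: carrier_vecI)
qed

section \<open>The conic reformulation\<close>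

text \<open>The slack of a point of the represented set lies in \<open>K\<close> and pairs
  nonnegatively with \<mu>. This gives the easy direction: feasible values of (b) bound
  \<open>Psi_bar\<close> from above.\<close>

lemma weak_conic_duality:
  fixes C D :: "real mat"
  assumes C: "C \<in> carrier_mat k n" and D: "D \<in> carrier_mat k nu" and e: "e \<in> carrier_vec k"
    and x: "x \<in> represented_set K C D e"
    and \<mu>: "\<mu> \<in> dual_cone k K" and zero: "transpose_mat D *\<^sub>v \<mu> = 0\<^sub>v nu"
  shows "(transpose_mat C *\<^sub>v \<mu>) \<bullet> x \<le> e \<bullet> \<mu>"
proof -
  obtain u where xc: "x \<in> carrier_vec n" and u: "u \<in> carrier_vec nu" "e - (C *\<^sub>v x + D *\<^sub>v u) \<in> K"
    using x C D by (auto simp: represented_set_def cone_le_def)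
  have \<mu>c: "\<mu> \<in> carrier_vec k" using \<mu> by (simp add: dual_cone_def)
  have "0 \<le> \<mu> \<bullet> (e - (C *\<^sub>v x + D *\<^sub>v u))" using \<mu> u(2) unfolding dual_cone_def by blast
  also have "\<dots> = e \<bullet> \<mu> - \<mu> \<bullet> (C *\<^sub>v x)" by (rule multiplier_slack[OF C D e xc u(1) \<mu>c zero])
  finally show ?thesis using transpose_vec_mult_scalar[OF C xc \<mu>c] by simp
qed

lemma conic_problem_multiplier_reformulation:
  fixes A B C D P Q R :: "real mat"
  assumes fam: "cone_family \<K>"
    and KX: "KX \<in> \<K> kX" and A: "A \<in> carrier_mat kX nx" and B: "B \<in> carrier_mat kX n\<xi>"
    and c: "c \<in> carrier_vec kX"
    and KY: "KY \<in> \<K> kY" and C: "C \<in> carrier_mat kY ny" and D: "D \<in> carrier_mat kY n\<eta>"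
    and e: "e \<in> carrier_vec kY"
    and K: "K \<in> \<K> k" and P: "P \<in> carrier_mat k ny" and p: "p \<in> carrier_vec k"
    and Q: "Q \<in> carrier_mat k nu" and R: "R \<in> carrier_mat k nx" and s: "s \<in> carrier_vec k"
    and V: "V = decisions nx n\<xi> ny nu kY"
    and F: "F = {(x, \<xi>, f, t, u, \<mu>). (x, \<xi>, f, t, u, \<mu>) \<in> V \<and>
          P *\<^sub>v f + t \<cdot>\<^sub>v p + Q *\<^sub>v u + R *\<^sub>v x \<preceq>\<^bsub>K\<^esub> s \<and>
          transpose_mat C *\<^sub>v \<mu> = f \<and> transpose_mat D *\<^sub>v \<mu> = 0\<^sub>v n\<eta> \<and>
          0\<^sub>v kY \<preceq>\<^bsub>dual_cone kY KY\<^esub> \<mu> \<and>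
          A *\<^sub>v x + B *\<^sub>v \<xi> \<preceq>\<^bsub>KX\<^esub> c}"
    and obj: "obj = (\<lambda>(x, \<xi>, f, t, u, \<mu>). e \<bullet> \<mu> + t)"
  shows "conic_problem \<K> (nx + n\<xi> + ny + 1 + nu + kY) V stack F obj"
proof -
  let ?N = "nx + n\<xi> + ny + 1 + nu + kY"
  let ?x = "slice 0 nx" and ?\<xi> = "slice nx n\<xi>" and ?f = "slice (nx + n\<xi>) ny"
    and ?t = "slice (nx + n\<xi> + ny) 1" and ?u = "slice (nx + n\<xi> + ny + 1) nu"
    and ?\<mu> = "slice (nx + n\<xi> + ny + 1 + nu) kY"
  \<comment> \<open>A one-column matrix turns the term \<open>t \<cdot>\<^sub>v p\<close> into a
    matrix acting on the block that holds \<open>t\<close>.\<close>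
  let ?p = "mat_of_cols k [p]"
  have pc: "?p \<in> carrier_mat k 1" by auto
  have pt: "?p *\<^sub>v vec_of_list [t] = t \<cdot>\<^sub>v p" for t
    using p by (intro eq_vecI) (auto simp: scalar_prod_def mat_of_cols_def)
  \<comment> \<open>Every constraint of (b) as a linear map of \<open>z\<close> against a constant:
    \<open>f\<close> is moved to the left of its equation, and the sign condition on \<mu> is read
    as \<open>- \<mu>\<close> below zero.\<close>
  define S where "S =
    {z \<in> carrier_vec ?N. P *\<^sub>v ?f z + ?p *\<^sub>v ?t z + Q *\<^sub>v ?u z + R *\<^sub>v ?x z \<preceq>\<^bsub>K\<^esub> s} \<inter>
    ({z \<in> carrier_vec ?N. transpose_mat C *\<^sub>v ?\<mu> z + - ?f z = 0\<^sub>v ny} \<inter>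
    ({z \<in> carrier_vec ?N. transpose_mat D *\<^sub>v ?\<mu> z = 0\<^sub>v n\<eta>} \<inter>
    ({z \<in> carrier_vec ?N. - ?\<mu> z \<preceq>\<^bsub>dual_cone kY KY\<^esub> 0\<^sub>v kY} \<inter>
     {z \<in> carrier_vec ?N. A *\<^sub>v ?x z + B *\<^sub>v ?\<xi> z \<preceq>\<^bsub>KX\<^esub> c})))"
  have CT: "transpose_mat C \<in> carrier_mat ny kY" and DT: "transpose_mat D \<in> carrier_mat n\<eta> kY"
    using C D by auto
  have dual: "dual_cone kY KY \<in> \<K> kY" using fam KY by (simp add: cone_family_def)
  have maps: "matrix_map ?N nx ?x" "matrix_map ?N n\<xi> ?\<xi>" "matrix_map ?N ny ?f" "matrix_map ?N 1 ?t"
      "matrix_map ?N nu ?u" "matrix_map ?N kY ?\<mu>"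
    by (intro matrix_map_slice; simp)+
  note mult = matrix_map_mult[OF maps(1) R] matrix_map_mult[OF maps(1) A] matrix_map_mult[OF maps(2) B]
    matrix_map_mult[OF maps(3) P] matrix_map_mult[OF maps(4) pc] matrix_map_mult[OF maps(5) Q]
    matrix_map_mult[OF maps(6) CT] matrix_map_mult[OF maps(6) DT]
  have "matrix_map ?N k (\<lambda>z. P *\<^sub>v ?f z + ?p *\<^sub>v ?t z + Q *\<^sub>v ?u z + R *\<^sub>v ?x z)"
    by (intro matrix_map_add mult)
  note c1 = conic_set_cone_le[where \<K> = \<K>, OF K this s]
  have "matrix_map ?N ny (\<lambda>z. transpose_mat C *\<^sub>v ?\<mu> z + - ?f z)"
    by (intro matrix_map_add matrix_map_uminus maps mult)
  note c2 = conic_set_eq_zero[OF fam this]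
  note c3 = conic_set_eq_zero[OF fam matrix_map_mult[OF maps(6) DT]]
  note c4 = conic_set_cone_le[where \<K> = \<K>, OF dual matrix_map_uminus[OF maps(6)] zero_carrier_vec]
  have "matrix_map ?N kX (\<lambda>z. A *\<^sub>v ?x z + B *\<^sub>v ?\<xi> z)"
    by (intro matrix_map_add mult)
  note c5 = conic_set_cone_le[where \<K> = \<K>, OF KX this c]
  have S: "conic_set \<K> ?N S"
    unfolding S_def by (intro conic_set_Int[OF fam] c1 c2 c3 c4 c5)
  have F_eq: "F = {\<zeta> \<in> V. stack \<zeta> \<in> S}"
  proof (rule Set.set_eqI)
    fix \<zeta> :: decision
    obtain x \<xi> f t u \<mu> where \<zeta>: "\<zeta> = (x, \<xi>, f, t, u, \<mu>)" by (metis prod_cases6)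
    show "\<zeta> \<in> F \<longleftrightarrow> \<zeta> \<in> {\<zeta> \<in> V. stack \<zeta> \<in> S}"
    proof (cases "\<zeta> \<in> V")
      case True
      then have d: "x \<in> carrier_vec nx" "\<xi> \<in> carrier_vec n\<xi>" "f \<in> carrier_vec ny"
          "u \<in> carrier_vec nu" "\<mu> \<in> carrier_vec kY"
        unfolding \<zeta> V by (auto simp: decisions_def)
      have eq: "transpose_mat C *\<^sub>v \<mu> + - f = 0\<^sub>v ny \<longleftrightarrow> transpose_mat C *\<^sub>v \<mu> = f"
      proof
        have Cm: "transpose_mat C *\<^sub>v \<mu> \<in> carrier_vec ny" using CT d(5) by (rule mult_mat_vec_carrier)
        assume z: "transpose_mat C *\<^sub>v \<mu> + - f = 0\<^sub>v ny"
        show "transpose_mat C *\<^sub>v \<mu> = f"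
        proof (rule eq_vecI)
          fix i assume "i < dim_vec f"
          then have i: "i < ny" using d(3) by simp
          have "(transpose_mat C *\<^sub>v \<mu> + - f) $ i = 0" using i by (simp only: z index_zero_vec)
          then have "(transpose_mat C *\<^sub>v \<mu>) $ i + - (f $ i) = 0"
            using i d(3) Cm by (simp only: index_add_vec index_uminus_vec carrier_vecD)
          then show "(transpose_mat C *\<^sub>v \<mu>) $ i = f $ i" by simp
        qed (use C d(3) in simp)
      next
        assume "transpose_mat C *\<^sub>v \<mu> = f"
        then show "transpose_mat C *\<^sub>v \<mu> + - f = 0\<^sub>v ny" using d(3) by auto
      qed
      have "0\<^sub>v kY - - \<mu> = \<mu>" "\<mu> - 0\<^sub>v kY = \<mu>" using d(5) by auto
      then have dual_le: "- \<mu> \<preceq>\<^bsub>dual_cone kY KY\<^esub> 0\<^sub>v kY \<longleftrightarrow> 0\<^sub>v kY \<preceq>\<^bsub>dual_cone kY KY\<^esub> \<mu>"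
        by (simp only: cone_le_def)
      have "stack \<zeta> \<in> S \<longleftrightarrow> P *\<^sub>v f + t \<cdot>\<^sub>v p + Q *\<^sub>v u + R *\<^sub>v x \<preceq>\<^bsub>K\<^esub> s \<and>
          transpose_mat C *\<^sub>v \<mu> = f \<and> transpose_mat D *\<^sub>v \<mu> = 0\<^sub>v n\<eta> \<and>
          0\<^sub>v kY \<preceq>\<^bsub>dual_cone kY KY\<^esub> \<mu> \<and> A *\<^sub>v x + B *\<^sub>v \<xi> \<preceq>\<^bsub>KX\<^esub> c"
        using stack_carrier[OF d, of t] unfolding \<zeta> S_def
        by (simp only: Int_iff mem_Collect_eq slice_stack[OF d] pt eq dual_le simp_thms)
      then show ?thesis using True unfolding F \<zeta> by simp
    next
      case False
      then show ?thesis unfolding F \<zeta> by simp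
    qed
  qed
  show ?thesis
  proof (rule conic_problemI[OF _ S F_eq])
    show "bij_betw stack V (carrier_vec ?N)" unfolding V by (rule stack_bij)
    show "stack (0\<^sub>v nx, 0\<^sub>v n\<xi>, 0\<^sub>v ny, 1, 0\<^sub>v nu, e) \<in> carrier_vec ?N"
      by (rule stack_carrier) (use e in simp_all)
    fix \<zeta> :: decision assume \<zeta>V: "\<zeta> \<in> V"
    obtain x \<xi> f t u \<mu> where \<zeta>: "\<zeta> = (x, \<xi>, f, t, u, \<mu>)" by (metis prod_cases6)
    have d: "x \<in> carrier_vec nx" "\<xi> \<in> carrier_vec n\<xi>" "f \<in> carrier_vec ny"
        "u \<in> carrier_vec nu" "\<mu> \<in> carrier_vec kY"
      using \<zeta>V unfolding \<zeta> V by (auto simp: decisions_def)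
    show "obj \<zeta> = stack (0\<^sub>v nx, 0\<^sub>v n\<xi>, 0\<^sub>v ny, 1, 0\<^sub>v nu, e) \<bullet> stack \<zeta>"
      unfolding \<zeta> obj scalar_prod_stack[OF d e] by simp
  qed
qed

theorem mainTheorem1:
  fixes \<K> :: "nat \<Rightarrow> real vec set set"
    and nx n\<xi> ny n\<eta> nu kX kY k :: nat
    and KX KY K :: "real vec set"
    and A B C D P Q R :: "real mat"
    and c e p s :: "real vec"
    and X Y :: "real vec set"
    and \<psi> :: "real vec \<Rightarrow> real vec \<Rightarrow> real"
    and V F :: "decision set"
    and obj :: "decision \<Rightarrow> real"
  assumes "cone_family \<K>"
    and "KX \<in> \<K> kX" "A \<in> carrier_mat kX nx" "B \<in> carrier_mat kX n\<xi>" "c \<in> carrier_vec kX"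
    and "KY \<in> \<K> kY" "C \<in> carrier_mat kY ny" "D \<in> carrier_mat kY n\<eta>" "e \<in> carrier_vec kY"
    and "K \<in> \<K> k" "P \<in> carrier_mat k ny" "p \<in> carrier_vec k" "Q \<in> carrier_mat k nu"
      "R \<in> carrier_mat k nx" "s \<in> carrier_vec k"
    and "X = represented_set KX A B c" "X \<noteq> {}"
    and "Y = represented_set KY C D e" "Y \<noteq> {}" "compactin (euclid ny) Y"
    and "ess_strictly_feasible KY (C @\<^sub>c D) e"
    and "continuous_map
          (prod_topology (subtopology (euclid nx) X) (subtopology (euclid ny) Y)) euclideanreal
          (\<lambda>(x, y). \<psi> x y)"
    and "convex_concave_on X Y \<psi>"
    and "saddle_represents X Y \<psi> K P p Q R s"
    and "V = decisions nx n\<xi> ny nu kY"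
    and "F = {(x, \<xi>, f, t, u, \<mu>). (x, \<xi>, f, t, u, \<mu>) \<in> V \<and>
          P *\<^sub>v f + t \<cdot>\<^sub>v p + Q *\<^sub>v u + R *\<^sub>v x \<preceq>\<^bsub>K\<^esub> s \<and>
          transpose_mat C *\<^sub>v \<mu> = f \<and> transpose_mat D *\<^sub>v \<mu> = 0\<^sub>v n\<eta> \<and>
          0\<^sub>v kY \<preceq>\<^bsub>dual_cone kY KY\<^esub> \<mu> \<and>
          A *\<^sub>v x + B *\<^sub>v \<xi> \<preceq>\<^bsub>KX\<^esub> c}"
    and "obj = (\<lambda>(x, \<xi>, f, t, u, \<mu>). e \<bullet> \<mu> + t)"
  shows "conic_problem \<K> (nx + n\<xi> + ny + 1 + nu + kY) V stack F obj \<and>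
    (\<forall>(x, \<xi>, f, t, u, \<mu>) \<in> F. x \<in> X \<and> Psi_bar Y \<psi> x \<le> e \<bullet> \<mu> + t) \<and>
    (INF x\<in>X. ereal (Psi_bar Y \<psi> x)) = (INF \<zeta>\<in>F. ereal (obj \<zeta>))"
proof (intro conjI)
  note fam = assms(1) and KX = assms(2) and A = assms(3) and B = assms(4) and c = assms(5)
    and KY = assms(6) and C = assms(7) and D = assms(8) and e = assms(9)
    and K = assms(10) and P = assms(11) and p = assms(12) and Q = assms(13) and R = assms(14)
    and s = assms(15) and X = assms(16) and Y = assms(18) and Y_ne = assms(19)
    and Y_compact = assms(20) and ess = assms(21) and repr = assms(24)
    and V = assms(25) and F = assms(26) and obj = assms(27)
  show "conic_problem \<K> (nx + n\<xi> + ny + 1 + nu + kY) V stack F obj"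
    by (rule conic_problem_multiplier_reformulation[OF fam KX A B c KY C D e K P p Q R s V F obj])
  have regular: "regular_cone kY KY" "regular_cone k K"
    using fam KY K by (auto simp: cone_family_def)
  have Xc: "X \<subseteq> carrier_vec nx" and Yc: "Y \<subseteq> carrier_vec ny"
    using A C by (auto simp: X Y represented_set_def)
  \<comment> \<open>Projecting out \<open>u\<close> leaves, for \<open>x \<in> X\<close>,
    coefficients of affine majorants of \<open>\<psi> x\<close> on \<open>Y\<close>.\<close>
  define G where "G x = {(f, t). \<exists>u. (f, t, u) \<in> saddle_repr_set K P p Q R s x}" for x
  have G_iff: "(f, t) \<in> G x \<longleftrightarrow> f \<in> carrier_vec ny \<and>
      (\<exists>u\<in>carrier_vec nu. P *\<^sub>v f + t \<cdot>\<^sub>v p + Q *\<^sub>v u + R *\<^sub>v x \<preceq>\<^bsub>K\<^esub> s)" for f t x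
    using P Q by (auto simp: G_def saddle_repr_set_def)
  have psi_Inf: "ereal (\<psi> x y) = (INF (f, t, u) \<in> saddle_repr_set K P p Q R s x. ereal (f \<bullet> y + t))"
    if "x \<in> X" "y \<in> Y" for x y
    using repr that by (simp add: saddle_represents_def)
  have psi_le: "\<psi> x y \<le> f \<bullet> y + t" if xy: "x \<in> X" "y \<in> Y" and ft: "(f, t) \<in> G x" for x y f t
  proof -
    obtain u where u: "(f, t, u) \<in> saddle_repr_set K P p Q R s x" using ft by (auto simp: G_def)
    have "ereal (\<psi> x y) \<le> ereal (f \<bullet> y + t)"
      unfolding psi_Inf[OF xy] by (rule INF_lower2[OF u]) simp
    then show ?thesis by simp
  qed
  have psi_ge: "r \<le> \<psi> x y" if xy: "x \<in> X" "y \<in> Y" and le: "\<And>f t. (f, t) \<in> G x \<Longrightarrow> r \<le> f \<bullet> y + t"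
    for x y r
  proof -
    have "ereal r \<le> ereal (\<psi> x y)"
      unfolding psi_Inf[OF xy]
    proof (rule INF_greatest)
      fix z assume z: "z \<in> saddle_repr_set K P p Q R s x"
      obtain f t u where ftu: "z = (f, t, u)" by (rule prod_cases3)
      then have "r \<le> f \<bullet> y + t" using z by (intro le) (auto simp: G_def)
      then show "ereal r \<le> (case z of (f, t, u) \<Rightarrow> ereal (f \<bullet> y + t))" by (simp add: ftu)
    qed
    then show ?thesis by simp
  qed
  have G_ne: "G x \<noteq> {}" if x: "x \<in> X" for x
  proof
    assume empty: "G x = {}"
    obtain y where y: "y \<in> Y" using Y_ne by blast
    \<comment> \<open>Over an empty \<open>G x\<close> any real passes as a lower bound, so
      \<open>psi_ge\<close> contradicts the finiteness of \<psi>.\<close>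
    have "\<psi> x y + 1 \<le> \<psi> x y" using empty by (intro psi_ge[OF x y]) auto
    then show False by simp
  qed
  \<comment> \<open>A single affine majorant from \<open>G x\<close>, bounded on the compact
    \<open>Y\<close>, bounds the supremum in \<open>Psi_bar\<close>.\<close>
  have bdd: "bdd_above (\<psi> x ` Y)" if x: "x \<in> X" for x
  proof -
    obtain f t where ft: "(f, t) \<in> G x" using G_ne[OF x] by auto
    obtain b where "\<And>y. y \<in> Y \<Longrightarrow> f \<bullet> y \<le> b"
      using compactin_euclid_scalar_prod_bounded[OF Y_compact Yc] by blast
    then have "\<psi> x y \<le> b + t" if "y \<in> Y" for y using psi_le[OF x that ft] that by fastforce
    then show ?thesis by (rule bdd_aboveI2)
  qed
  have feasible: "x \<in> X \<and> Psi_bar Y \<psi> x \<le> e \<bullet> \<mu> + t" if "(x, \<xi>, f, t, u, \<mu>) \<in> F" for x \<xi> f t u \<mu>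
  proof
    have d: "x \<in> carrier_vec nx" "\<xi> \<in> carrier_vec n\<xi>" "f \<in> carrier_vec ny" "u \<in> carrier_vec nu"
        "\<mu> \<in> carrier_vec kY"
      and feas: "P *\<^sub>v f + t \<cdot>\<^sub>v p + Q *\<^sub>v u + R *\<^sub>v x \<preceq>\<^bsub>K\<^esub> s"
        "transpose_mat C *\<^sub>v \<mu> = f" "transpose_mat D *\<^sub>v \<mu> = 0\<^sub>v n\<eta>"
        "0\<^sub>v kY \<preceq>\<^bsub>dual_cone kY KY\<^esub> \<mu>" "A *\<^sub>v x + B *\<^sub>v \<xi> \<preceq>\<^bsub>KX\<^esub> c"
      using that by (auto simp: F V decisions_def)
    show x: "x \<in> X" using d A B feas(5) by (auto simp: X represented_set_def)
    have "\<mu> - 0\<^sub>v kY = \<mu>" using d(5) by auto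
    then have \<mu>: "\<mu> \<in> dual_cone kY KY" using feas(4) by (simp add: cone_le_def)
    have ft: "(f, t) \<in> G x" using d feas(1) by (auto simp: G_iff)
    show "Psi_bar Y \<psi> x \<le> e \<bullet> \<mu> + t" unfolding Psi_bar_def
    proof (rule cSUP_least[OF Y_ne])
      fix y assume y: "y \<in> Y"
      then have "f \<bullet> y \<le> e \<bullet> \<mu>"
        using weak_conic_duality[OF C D e _ \<mu> feas(3)] by (simp add: Y feas(2))
      then show "\<psi> x y \<le> e \<bullet> \<mu> + t" using psi_le[OF x y ft] by simp
    qed
  qed
  then show "\<forall>(x, \<xi>, f, t, u, \<mu>) \<in> F. x \<in> X \<and> Psi_bar Y \<psi> x \<le> e \<bullet> \<mu> + t" by fast
  have G_convex: "(a \<cdot>\<^sub>v f + b \<cdot>\<^sub>v f', a * t + b * t') \<in> G x"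
    if x: "x \<in> X" and G: "(f, t) \<in> G x" "(f', t') \<in> G x" and ab: "0 \<le> a" "0 \<le> b" "a + b = 1"
    for x f t f' t' a b
  proof -
    have xc: "x \<in> carrier_vec nx" using x Xc by auto
    obtain u where f: "f \<in> carrier_vec ny" and u: "u \<in> carrier_vec nu"
      and m: "s - (P *\<^sub>v f + t \<cdot>\<^sub>v p + Q *\<^sub>v u + R *\<^sub>v x) \<in> K"
      using G(1) by (auto simp: G_iff cone_le_def)
    obtain u' where f': "f' \<in> carrier_vec ny" and u': "u' \<in> carrier_vec nu"
      and m': "s - (P *\<^sub>v f' + t' \<cdot>\<^sub>v p + Q *\<^sub>v u' + R *\<^sub>v x) \<in> K"
      using G(2) by (auto simp: G_iff cone_le_def)
    let ?l = "s - (P *\<^sub>v (a \<cdot>\<^sub>v f + b \<cdot>\<^sub>v f') + (a * t + b * t') \<cdot>\<^sub>v p + Q *\<^sub>v (a \<cdot>\<^sub>v u + b \<cdot>\<^sub>v u') + R *\<^sub>v x)"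
    let ?r = "a \<cdot>\<^sub>v (s - (P *\<^sub>v f + t \<cdot>\<^sub>v p + Q *\<^sub>v u + R *\<^sub>v x)) +
      b \<cdot>\<^sub>v (s - (P *\<^sub>v f' + t' \<cdot>\<^sub>v p + Q *\<^sub>v u' + R *\<^sub>v x))"
    have Pl: "P *\<^sub>v (a \<cdot>\<^sub>v f + b \<cdot>\<^sub>v f') = a \<cdot>\<^sub>v (P *\<^sub>v f) + b \<cdot>\<^sub>v (P *\<^sub>v f')"
      using P f f' by (simp add: mult_add_distrib_mat_vec[of _ k ny] mult_mat_vec[of _ k ny])
    have Ql: "Q *\<^sub>v (a \<cdot>\<^sub>v u + b \<cdot>\<^sub>v u') = a \<cdot>\<^sub>v (Q *\<^sub>v u) + b \<cdot>\<^sub>v (Q *\<^sub>v u')"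
      using Q u u' by (simp add: mult_add_distrib_mat_vec[of _ k nu] mult_mat_vec[of _ k nu])
    have b: "b = 1 - a" using ab(3) by simp
    \<comment> \<open>Opaque names for the images let the coordinatewise comparison work with plain
      entries instead of rows times vectors.\<close>
    define pf pf' qu qu' rx where "pf = P *\<^sub>v f" and "pf' = P *\<^sub>v f'" and "qu = Q *\<^sub>v u"
      and "qu' = Q *\<^sub>v u'" and "rx = R *\<^sub>v x"
    note image_defs = this
    have "pf \<in> carrier_vec k" "pf' \<in> carrier_vec k" "qu \<in> carrier_vec k" "qu' \<in> carrier_vec k"
      "rx \<in> carrier_vec k"
      unfolding image_defs using P Q R f f' u u' xc by auto
    then have "?l = ?r"
      unfolding Pl Ql image_defs[symmetric] using p s
      by (intro eq_vecI) (auto simp: b algebra_simps)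
    moreover have "?r \<in> K"
      using regular(2) m m' ab unfolding regular_cone_def vec_convex_def by blast
    ultimately have "?l \<in> K" by simp
    moreover have "a \<cdot>\<^sub>v f + b \<cdot>\<^sub>v f' \<in> carrier_vec ny" "a \<cdot>\<^sub>v u + b \<cdot>\<^sub>v u' \<in> carrier_vec nu"
      using f f' u u' by auto
    ultimately show ?thesis unfolding G_iff cone_le_def by blast
  qed
  \<comment> \<open>The multiplier lemma is applied at the fixed \<open>x\<close>; membership in
    \<open>X\<close> then supplies \<xi>, and membership in \<open>G x\<close> supplies
    \<open>u\<close>.\<close>
  have approx: "\<exists>\<zeta>\<in>F. obj \<zeta> < v" if x: "x \<in> X" and v: "Psi_bar Y \<psi> x < v" for x v
  proof -
    have "\<exists>f t \<mu>. (f, t) \<in> G x \<and> \<mu> \<in> dual_cone kY KY \<and> transpose_mat C *\<^sub>v \<mu> = f \<and>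
        transpose_mat D *\<^sub>v \<mu> = 0\<^sub>v n\<eta> \<and> e \<bullet> \<mu> + t < v"
    proof (rule conic_minimax_multiplier[OF regular(1) C D e ess Y Y_compact _ G_ne[OF x]
          G_convex[OF x] psi_le[OF x] psi_ge[OF x] _ v])
      show "fst ` G x \<subseteq> carrier_vec ny" by (auto simp: G_iff)
      show "\<psi> x y \<le> Psi_bar Y \<psi> x" if "y \<in> Y" for y
        unfolding Psi_bar_def by (rule cSUP_upper[OF that bdd[OF x]])
    qed
    then obtain f t \<mu> where ft: "(f, t) \<in> G x" and \<mu>: "\<mu> \<in> dual_cone kY KY"
      and eqs: "transpose_mat C *\<^sub>v \<mu> = f" "transpose_mat D *\<^sub>v \<mu> = 0\<^sub>v n\<eta>"
      and less: "e \<bullet> \<mu> + t < v" by blast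
    have \<mu>c: "\<mu> \<in> carrier_vec kY" using \<mu> by (simp add: dual_cone_def)
    obtain \<xi> where \<xi>: "\<xi> \<in> carrier_vec n\<xi>" "A *\<^sub>v x + B *\<^sub>v \<xi> \<preceq>\<^bsub>KX\<^esub> c"
      using x B by (auto simp: X represented_set_def)
    obtain u where u: "f \<in> carrier_vec ny" "u \<in> carrier_vec nu"
        "P *\<^sub>v f + t \<cdot>\<^sub>v p + Q *\<^sub>v u + R *\<^sub>v x \<preceq>\<^bsub>K\<^esub> s"
      using ft by (auto simp: G_iff)
    have "\<mu> - 0\<^sub>v kY = \<mu>" using \<mu>c by auto
    then have "(x, \<xi>, f, t, u, \<mu>) \<in> F"
      using x Xc \<xi> u eqs \<mu> \<mu>c by (auto simp: F V decisions_def cone_le_def)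
    then show ?thesis using less by (intro bexI[of _ "(x, \<xi>, f, t, u, \<mu>)"]) (auto simp: obj)
  qed
  show "(INF x\<in>X. ereal (Psi_bar Y \<psi> x)) = (INF \<zeta>\<in>F. ereal (obj \<zeta>))"
  proof (rule antisym)
    show "(INF x\<in>X. ereal (Psi_bar Y \<psi> x)) \<le> (INF \<zeta>\<in>F. ereal (obj \<zeta>))"
    proof (rule INF_greatest)
      fix \<zeta> assume \<zeta>F: "\<zeta> \<in> F"
      obtain x \<xi> f t u \<mu> where \<zeta>: "\<zeta> = (x, \<xi>, f, t, u, \<mu>)" by (metis prod_cases6)
      have "x \<in> X" "Psi_bar Y \<psi> x \<le> obj \<zeta>"
        using feasible \<zeta>F unfolding \<zeta> obj by auto
      then show "(INF x\<in>X. ereal (Psi_bar Y \<psi> x)) \<le> ereal (obj \<zeta>)"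
        by (intro INF_lower2[of x]) auto
    qed
    show "(INF \<zeta>\<in>F. ereal (obj \<zeta>)) \<le> (INF x\<in>X. ereal (Psi_bar Y \<psi> x))"
    proof (rule INF_greatest)
      fix x assume x: "x \<in> X"
      show "(INF \<zeta>\<in>F. ereal (obj \<zeta>)) \<le> ereal (Psi_bar Y \<psi> x)"
      proof (rule ereal_le_epsilon2)
        fix \<epsilon> :: real assume "0 < \<epsilon>"
        then obtain \<zeta> where "\<zeta> \<in> F" "obj \<zeta> < Psi_bar Y \<psi> x + \<epsilon>"
          using approx[OF x, of "Psi_bar Y \<psi> x + \<epsilon>"] by auto
        then show "(INF \<zeta>\<in>F. ereal (obj \<zeta>)) \<le> ereal (Psi_bar Y \<psi> x) + ereal \<epsilon>"
          by (intro INF_lower2[of \<zeta>]) auto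
      qed
    qed
  qed
qed

end
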